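(* Let $w>0$ be an integer. If $w$ is even, let \[ d_w(z,q)=(1-z)\prod_{i=1}^{w}(1-z^i)\prod_{i=1}^{w/2}(1-q^{2i}z), \] and if $w$ is odd, let \[ d_w(z,q)=\prod_{i=1}^{w}(1-z^{2i})\prod_{i=1}^{(w+1)/2}(1-q^{2i-1}z). \] Then for every partition $\mu$ of $w$, the series $d_w(z,q)A_\mu(z,q)$ is an element of $\mathbb{Z}[z,q]$.
   Context: For $n\geqslant 0$ let $[n]_q=\frac{q^n-q^{-n}}{q-q^{-1}}$. For a partition $\mu$ and an integer $h\geqslant 0$, the Laurent polynomial $s_\mu(q^{-h},q^{-h+2},\ldots,q^{h})$ (Schur polynomial in $h+1$ variables) is invariant under $q\mapsto q^{-1}$ and can be written uniquely as $\sum_{k\geqslant 1} a_{\mu[h]}^{[k]}[k]_q$ with integers $a_{\mu[h]}^{[k]}$. Define the formal power series $A_\mu(z,q)=\sum_{k\geqslant 1,\,h\geqslant 0} a_{\mu[h]}^{[k]}q^kz^h$. *)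

theory Defs
  imports
    "HOL-Computational_Algebra.Formal_Laurent_Series"
    "HOL-Computational_Algebra.Polynomial_FPS"
    "HOL-Library.FuncSet"
begin

definition partition_of :: "nat \<Rightarrow> nat list \<Rightarrow> bool" where
  "partition_of w \<mu> \<longleftrightarrow> sorted_wrt (\<ge>) \<mu> \<and> 0 \<notin> set \<mu> \<and> sum_list \<mu> = w"

text \<open>Row and column indices of Young diagrams, and tableau entries, start at 0.\<close>

definition young_diagram :: "nat list \<Rightarrow> (nat \<times> nat) set" where
  "young_diagram \<mu> = {(i, j). i < length \<mu> \<and> j < \<mu> ! i}"

definition semistandard_tableaux :: "nat list \<Rightarrow> nat \<Rightarrow> (nat \<times> nat \<Rightarrow> nat) set" where
  "semistandard_tableaux \<mu> n =
     {T \<in> young_diagram \<mu> \<rightarrow>\<^sub>E {..<n}.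
        (\<forall>i j j'. j < j' \<longrightarrow> (i, j) \<in> young_diagram \<mu> \<longrightarrow> (i, j') \<in> young_diagram \<mu> \<longrightarrow>
           T (i, j) \<le> T (i, j')) \<and>
        (\<forall>i i' j. i < i' \<longrightarrow> (i, j) \<in> young_diagram \<mu> \<longrightarrow> (i', j) \<in> young_diagram \<mu> \<longrightarrow>
           T (i, j) < T (i', j))}"

text \<open>The value \<open>s\<^sub>\<mu>(x\<^sub>0, \<dots>, x\<^sub>n\<^sub>-\<^sub>1)\<close> of the Schur polynomial in \<open>n\<close> variables.\<close>

definition schur :: "nat list \<Rightarrow> nat \<Rightarrow> (nat \<Rightarrow> 'a::comm_semiring_1) \<Rightarrow> 'a" where
  "schur \<mu> n x = (\<Sum>T\<in>semistandard_tableaux \<mu> n. \<Prod>c\<in>young_diagram \<mu>. x (T c))"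

text \<open>Laurent polynomials in \<open>q\<close> are regarded as elements of the field of formal Laurent
  series over the rationals, with \<open>q\<close> being \<^const>\<open>fls_X\<close>.\<close>

definition q_int :: "nat \<Rightarrow> rat fls" where
  "q_int n = (fls_X powi int n - fls_X powi (- int n)) / (fls_X - fls_X powi (-1))"

definition schur_spec :: "nat list \<Rightarrow> nat \<Rightarrow> rat fls" where
  "schur_spec \<mu> h = schur \<mu> (h + 1) (\<lambda>i. fls_X powi (2 * int i - int h))"

text \<open>The integers \<open>a k\<close> for \<open>k \<ge> 1\<close>. As \<open>q_int 0 = 0\<close>, the value at 0
  is irrelevant and normalised to 0.\<close>

definition schur_coeff :: "nat list \<Rightarrow> nat \<Rightarrow> nat \<Rightarrow> int" where
  "schur_coeff \<mu> h =
     (THE a. a 0 = 0 \<and> finite {k. a k \<noteq> 0} \<and>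
             schur_spec \<mu> h = (\<Sum>k | a k \<noteq> 0. of_int (a k) * q_int k))"

text \<open>Power series in \<open>z\<close> and \<open>q\<close>: the outer variable is \<open>z\<close>, the inner one is \<open>q\<close>.\<close>

abbreviation zvar :: "int fps fps" where
  "zvar \<equiv> fps_X"

abbreviation qvar :: "int fps fps" where
  "qvar \<equiv> fps_const fps_X"

definition A_series :: "nat list \<Rightarrow> int fps fps" where
  "A_series \<mu> = Abs_fps (\<lambda>h. Abs_fps (\<lambda>k. if k \<ge> 1 then schur_coeff \<mu> h k else 0))"

definition d_poly :: "nat \<Rightarrow> int fps fps" where
  "d_poly w =
     (if even w
      then (1 - zvar) * (\<Prod>i=1..w. 1 - zvar ^ i) * (\<Prod>i=1..w div 2. 1 - qvar ^ (2 * i) * zvar)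
      else (\<Prod>i=1..w. 1 - zvar ^ (2 * i)) *
           (\<Prod>i=1..(w + 1) div 2. 1 - qvar ^ (2 * i - 1) * zvar))"

text \<open>The subring \<open>\<int>[z, q] = \<int>[q][z]\<close> of \<open>\<int>[[q]][[z]]\<close>.\<close>

definition polys_zq :: "int fps fps set" where
  "polys_zq = range (\<lambda>P :: int poly poly. fps_of_poly (map_poly fps_of_poly P))"

end

theory Submission
  imports Defs
begin

text \<open>
  Multiplying \<open>\<Sum> a\<^sub>k [k]\<^sub>q\<close> by \<open>q - q\<^sup>-\<^sup>1\<close> gives \<open>\<Sum> a\<^sub>k (q\<^sup>k - q\<^sup>-\<^sup>k)\<close>, so \<open>A\<^sub>\<mu>\<close> is the part with positive
  \<open>q\<close>-exponents of \<open>F = \<Sum> (q - q\<^sup>-\<^sup>1) s\<^sub>\<mu>(q\<^sup>-\<^sup>h, \<dots>, q\<^sup>h) z\<^sup>h\<close>. Removing the largest entries of a tableau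
  shows that \<open>s\<^sub>\<mu>(1, u, \<dots>, u\<^sup>h)\<close> is a linear combination of the exponentials \<open>u\<^sup>i\<^sup>h\<close> with
  \<open>0 \<le> i \<le> w\<close>; hence \<open>F = N / \<Prod> (1 - q\<^sup>j z)\<close> with \<open>j\<close> running through \<open>-w, -w + 2, \<dots>, w\<close> and \<open>N\<close> a
  Laurent polynomial.

  Let \<open>P\<^sub>+\<close> and \<open>P\<^sub>-\<close> be the products of the factors with \<open>j > 0\<close> and \<open>j < 0\<close>. If \<open>x = q\<^sup>i z\<close> and
  \<open>y = q\<^sup>-\<^sup>j z\<close>, then a monomial \<open>x\<^sup>m y\<^sup>n\<close> with \<open>i m = j n\<close> equals \<open>z\<^sup>m\<^sup>+\<^sup>n\<close>, so \<open>1 - z\<^sup>m\<^sup>+\<^sup>n\<close> lies in the ideal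
  \<open>(1 - x, 1 - y)\<close>. Applying this to the outermost factors and inducting on their number puts a
  product \<open>D\<close> of factors \<open>1 - z\<^sup>i\<close> (those in \<open>d\<^sub>w\<close>) into the ideal \<open>(P\<^sub>+, P\<^sub>-)\<close>. Therefore \<open>D F\<close>, up to a
  factor \<open>1 - z\<close>, is a sum of a fraction over \<open>P\<^sub>+\<close> and one over \<open>P\<^sub>-\<close>. The positive part of the
  latter is a polynomial, and so is the nonpositive part of the former up to powers of \<open>q\<close>; hence
  \<open>P\<^sub>+ D A\<^sub>\<mu>\<close> has finite support.
\<close>

unbundle fps_syntax

section \<open>Fillings of a finite set with prescribed inequalities\<close>

text \<open>Only relations on an arbitrary set are used, so that deleting the cells with the largest
  entry leads to an object of the same kind, whatever its shape.\<close>

definition fillings ::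
  "('c \<Rightarrow> 'c \<Rightarrow> bool) \<Rightarrow> ('c \<Rightarrow> 'c \<Rightarrow> bool) \<Rightarrow> 'c set \<Rightarrow> nat \<Rightarrow> ('c \<Rightarrow> nat) set" where
  "fillings r s C n = {T \<in> C \<rightarrow>\<^sub>E {..<n}.
     (\<forall>a\<in>C. \<forall>b\<in>C. (r a b \<longrightarrow> T a \<le> T b) \<and> (s a b \<longrightarrow> T a < T b))}"

text \<open>The candidates for the set of cells carrying the largest possible entry: weak successors
  of such a cell carry it too, and strict successors cannot exist.\<close>

definition top_sets :: "('c \<Rightarrow> 'c \<Rightarrow> bool) \<Rightarrow> ('c \<Rightarrow> 'c \<Rightarrow> bool) \<Rightarrow> 'c set \<Rightarrow> 'c set set" where
  "top_sets r s C = {X. X \<subseteq> C \<and> (\<forall>a\<in>X. \<forall>b\<in>C. (r a b \<longrightarrow> b \<in> X) \<and> \<not> s a b)}"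

definition filling_sum ::
  "('c \<Rightarrow> 'c \<Rightarrow> bool) \<Rightarrow> ('c \<Rightarrow> 'c \<Rightarrow> bool) \<Rightarrow> 'c set \<Rightarrow> nat \<Rightarrow> (nat \<Rightarrow> 'a::comm_semiring_1) \<Rightarrow> 'a" where
  "filling_sum r s C n x = (\<Sum>T\<in>fillings r s C n. \<Prod>c\<in>C. x (T c))"

lemma finite_fillings: "finite C \<Longrightarrow> finite (fillings r s C n)"
  unfolding fillings_def by (rule finite_subset[OF _ finite_PiE[of C "\<lambda>_. {..<n}"]]) auto

lemma finite_top_sets: "finite C \<Longrightarrow> finite (top_sets r s C)"
  unfolding top_sets_def by (rule finite_subset[of _ "Pow C"]) auto

lemma empty_in_top_sets: "{} \<in> top_sets r s C"
  by (simp add: top_sets_def)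

lemma filling_sum_empty [simp]: "filling_sum r s {} n x = 1"
  by (simp add: filling_sum_def fillings_def)

lemma filling_sum_0: "C \<noteq> {} \<Longrightarrow> filling_sum r s C 0 x = 0"
  by (auto simp: filling_sum_def fillings_def PiE_eq_empty_iff intro!: sum.neutral)

text \<open>A filling corresponds to the set \<open>X\<close> of cells with entry \<open>n\<close>
  together with its restriction to \<open>C - X\<close>, where all entries are below
  \<open>n\<close>.\<close>

lemma filling_sum_Suc:
  fixes x :: "nat \<Rightarrow> 'a::comm_semiring_1"
  assumes "finite C"
  shows "filling_sum r s C (Suc n) x =
    (\<Sum>X\<in>top_sets r s C. x n ^ card X * filling_sum r s (C - X) n x)"
proof -
  let ?g = "\<lambda>X T c. if c \<in> X then n else T c"
  have prod_eq: "(\<Prod>c\<in>C. x (?g X T c)) = x n ^ card X * (\<Prod>c\<in>C - X. x (T c))"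
    if "X \<in> top_sets r s C" for X T
  proof -
    have X: "X \<subseteq> C" "finite X" using that assms by (auto simp: top_sets_def intro: finite_subset)
    have "(\<Prod>c\<in>C. x (?g X T c)) = (\<Prod>c\<in>C - X. x (?g X T c)) * (\<Prod>c\<in>X. x (?g X T c))"
      using X assms by (simp add: prod.subset_diff)
    also have "(\<Prod>c\<in>C - X. x (?g X T c)) = (\<Prod>c\<in>C - X. x (T c))" by (rule prod.cong) auto
    also have "(\<Prod>c\<in>X. x (?g X T c)) = x n ^ card X" by simp
    finally show ?thesis by (simp add: mult.commute)
  qed
  have "(\<Sum>X\<in>top_sets r s C. x n ^ card X * filling_sum r s (C - X) n x) =
    (\<Sum>X\<in>top_sets r s C. \<Sum>T\<in>fillings r s (C - X) n. \<Prod>c\<in>C. x (?g X T c))"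
    by (intro sum.cong refl) (simp add: prod_eq filling_sum_def sum_distrib_left)
  also have "\<dots> = (\<Sum>(X, T)\<in>(SIGMA X:top_sets r s C. fillings r s (C - X) n).
      \<Prod>c\<in>C. x (?g X T c))"
    using assms by (intro sum.Sigma) (auto simp: finite_top_sets finite_fillings)
  also have "\<dots> = (\<Sum>T\<in>fillings r s C (Suc n). \<Prod>c\<in>C. x (T c))"
  proof (rule sum.reindex_bij_witness
      [where j = "\<lambda>(X, T). ?g X T" and
        i = "\<lambda>T. ({c\<in>C. T c = n}, restrict T (C - {c\<in>C. T c = n}))"], goal_cases)
    case (1 a)
    obtain X T where a: "a = (X, T)" "X \<subseteq> C" "T \<in> (C - X) \<rightarrow>\<^sub>E {..<n}"
      using 1 by (cases a) (auto simp: top_sets_def fillings_def)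
    have "T c \<noteq> n" if "c \<in> C" "c \<notin> X" for c using a that by (auto simp: PiE_def Pi_def)
    then have "{c \<in> C. ?g X T c = n} = X" using a by auto
    moreover have "restrict (?g X T) (C - X) = T"
      using a by (auto simp: restrict_def PiE_def extensional_def)
    ultimately show ?case using a by simp
  next
    case (2 a)
    obtain X T where a: "a = (X, T)" "X \<in> top_sets r s C" "T \<in> fillings r s (C - X) n"
      using 2 by auto
    have T: "T c < n" if "c \<in> C" "c \<notin> X" for c
      using a that by (auto simp: fillings_def PiE_def Pi_def)
    have "?g X T \<in> C \<rightarrow>\<^sub>E {..<Suc n}"
      using a T by (auto simp: top_sets_def fillings_def PiE_def extensional_def less_Suc_eq)
    moreover have "(r c d \<longrightarrow> ?g X T c \<le> ?g X T d) \<and> (s c d \<longrightarrow> ?g X T c < ?g X T d)"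
      if "c \<in> C" "d \<in> C" for c d
      using a T[of c] T[of d] that by (auto simp: top_sets_def fillings_def)
    ultimately show ?case using a by (simp add: fillings_def)
  next
    case (3 T)
    then have "T \<in> extensional C" by (auto simp: fillings_def PiE_def)
    then show ?case by (auto simp: fun_eq_iff extensional_def)
  next
    case (4 T)
    have T: "T c \<le> n" if "c \<in> C" for c
      using 4 that by (auto simp: fillings_def PiE_def Pi_def less_Suc_eq_le)
    have "{c \<in> C. T c = n} \<in> top_sets r s C"
      using 4 T by (fastforce simp: top_sets_def fillings_def)
    moreover have "restrict T (C - {c \<in> C. T c = n}) \<in> fillings r s (C - {c \<in> C. T c = n}) n"
      using 4 T by (fastforce simp: fillings_def le_less)
    ultimately show ?case by simp
  next
    case (5 a)
    then show ?case by auto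
  qed
  finally show ?thesis by (simp add: filling_sum_def)
qed

text \<open>The term \<open>c i * u ^ (i * n)\<close> is the forward difference of
  \<open>d i * u ^ (i * n)\<close> for \<open>d i = c i / (u ^ i - 1)\<close>. Since the sum starts
  at \<open>i = 1\<close>, no term linear in \<open>n\<close> arises; the coefficient at
  \<open>0\<close> absorbs the initial value.\<close>

lemma geometric_span_sum:
  fixes u :: "'a::field"
  assumes u: "\<And>i. i \<ge> 1 \<Longrightarrow> u ^ i \<noteq> 1"
    and step: "\<And>n. f (Suc n) = f n + (\<Sum>i=1..m. c i * u ^ (i * n))"
  shows "\<exists>c'. \<forall>n. f n = (\<Sum>i\<le>m. c' i * u ^ (i * n))"
proof -
  define d where "d i = c i / (u ^ i - 1)" for i
  define c' where "c' = (\<lambda>i. if i = 0 then f 0 - (\<Sum>i=1..m. d i) else d i)"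
  have sum_c': "(\<Sum>i\<le>m. c' i * u ^ (i * n)) = c' 0 + (\<Sum>i=1..m. d i * u ^ (i * n))" for n
    by (simp add: atMost_atLeast0 sum.atLeast_Suc_atMost c'_def)
  have "f n = c' 0 + (\<Sum>i=1..m. d i * u ^ (i * n))" for n
  proof (induction n)
    case 0
    then show ?case by (simp add: c'_def)
  next
    case (Suc n)
    have "d i * u ^ (i * Suc n) = d i * u ^ (i * n) + c i * u ^ (i * n)" if "i \<ge> 1" for i
    proof -
      have "c i = d i * (u ^ i - 1)" using u[OF that] by (simp add: d_def)
      then show ?thesis by (simp only: mult_Suc_right power_add) (simp add: algebra_simps)
    qed
    then have "(\<Sum>i=1..m. d i * u ^ (i * Suc n)) =
        (\<Sum>i=1..m. d i * u ^ (i * n)) + (\<Sum>i=1..m. c i * u ^ (i * n))"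
      unfolding sum.distrib[symmetric] by (intro sum.cong) auto
    then show ?case using Suc step[of n] by simp
  qed
  then show ?thesis using sum_c' by metis
qed

text \<open>Induction on the size of \<open>C\<close>. In \<open>filling_sum_Suc\<close> the empty
  top set reproduces the value at \<open>n\<close>; every other \<open>X\<close> contributes
  exponentials with \<open>i\<close> between \<open>card X\<close> and \<open>card C\<close>, so
  \<open>geometric_span_sum\<close> applies.\<close>

lemma filling_sum_geometric_span:
  fixes u :: "'a::field"
  assumes u: "\<And>i. i \<ge> 1 \<Longrightarrow> u ^ i \<noteq> 1"
  shows "finite C \<Longrightarrow> \<exists>c. \<forall>n. filling_sum r s C n (\<lambda>i. u ^ i) = (\<Sum>i\<le>card C. c i * u ^ (i * n))"
proof (induction "card C" arbitrary: C rule: less_induct)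
  case less
  let ?f = "\<lambda>C n. filling_sum r s C n (\<lambda>i. u ^ i)"
  let ?X = "top_sets r s C - {{}}"
  have X: "X \<subseteq> C \<and> finite X \<and> card X \<ge> 1 \<and> card X \<le> card C \<and> card (C - X) = card C - card X"
    if "X \<in> ?X" for X
  proof -
    have "X \<subseteq> C" "X \<noteq> {}" using that by (auto simp: top_sets_def)
    then show ?thesis using less.prems
      by (metis One_nat_def Suc_leI card_Diff_subset card_gt_0_iff card_mono finite_subset)
  qed
  have "\<exists>c. \<forall>n. ?f (C - X) n = (\<Sum>i\<le>card C - card X. c i * u ^ (i * n))" if "X \<in> ?X" for X
    using less.hyps[of "C - X"] X[OF that] less.prems by auto
  then obtain c where c: "\<And>X n. X \<in> ?X \<Longrightarrow>
      ?f (C - X) n = (\<Sum>i\<le>card C - card X. c X i * u ^ (i * n))"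
    by metis
  \<comment> \<open>Multiplication by \<open>u ^ (n * card X)\<close> shifts the coefficients
    \<open>c X\<close> by \<open>card X\<close>.\<close>
  define e where "e X i = (if i < card X then 0 else c X (i - card X))" for X i
  have e: "(u ^ n) ^ card X * ?f (C - X) n = (\<Sum>i=1..card C. e X i * u ^ (i * n))"
    if "X \<in> ?X" for X n
  proof -
    have "(\<Sum>i=1..card C. e X i * u ^ (i * n)) = (\<Sum>i=card X..card C. e X i * u ^ (i * n))"
      using X[OF that] by (intro sum.mono_neutral_right) (auto simp: e_def)
    also have "\<dots> = (\<Sum>i\<le>card C - card X. e X (i + card X) * u ^ ((i + card X) * n))"
      using X[OF that]
      by (intro sum.reindex_bij_witness[where i = "\<lambda>i. i + card X" and j = "\<lambda>i. i - card X"]) auto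
    also have "\<dots> = (u ^ n) ^ card X * ?f (C - X) n"
      unfolding c[OF that] sum_distrib_left
      by (intro sum.cong) (auto simp: e_def algebra_simps power_add power_mult)
    finally show ?thesis by simp
  qed
  have "?f C (Suc n) = ?f C n + (\<Sum>i=1..card C. (\<Sum>X\<in>?X. e X i) * u ^ (i * n))" for n
  proof -
    have "?f C (Suc n) = (\<Sum>X\<in>top_sets r s C. (u ^ n) ^ card X * ?f (C - X) n)"
      by (rule filling_sum_Suc) fact
    also have "\<dots> = ?f C n + (\<Sum>X\<in>?X. (u ^ n) ^ card X * ?f (C - X) n)"
      using less.prems by (subst sum.remove[of _ "{}"]) (auto simp: finite_top_sets empty_in_top_sets)
    also have "(\<Sum>X\<in>?X. (u ^ n) ^ card X * ?f (C - X) n) =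
        (\<Sum>i=1..card C. (\<Sum>X\<in>?X. e X i) * u ^ (i * n))"
      by (simp add: e sum_distrib_right) (rule sum.swap)
    finally show ?thesis .
  qed
  then show ?case by (rule geometric_span_sum[OF u, rotated]) auto
qed

section \<open>Reversing the variables of a Schur polynomial\<close>

text \<open>For weakly decreasing \<open>\<mu>\<close> this says that \<open>\<mu>/\<kappa>\<close>
  is a horizontal strip. Partitions become zero-padded functions, so no lengths have to be
  compared.\<close>

definition interlacing :: "(nat \<Rightarrow> nat) \<Rightarrow> (nat \<Rightarrow> nat) set" where
  "interlacing \<mu> = {\<kappa>. \<forall>i. \<mu> (Suc i) \<le> \<kappa> i \<and> \<kappa> i \<le> \<mu> i}"

text \<open>The branching rule for Schur polynomials, iterated over Gelfand--Tsetlin patterns. The parameter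
  \<open>L\<close> bounds the number of rows and only serves to write skew sizes as finite sums.\<close>

fun gt_sum :: "nat \<Rightarrow> (nat \<Rightarrow> nat) \<Rightarrow> 'a::comm_semiring_1 list \<Rightarrow> 'a" where
  "gt_sum L \<mu> [] = (if \<mu> = (\<lambda>_. 0) then 1 else 0)"
| "gt_sum L \<mu> (x # xs) = (\<Sum>\<kappa>\<in>interlacing \<mu>. x ^ (\<Sum>i<L. \<mu> i - \<kappa> i) * gt_sum L \<kappa> xs)"

lemma finite_interlacing:
  assumes "\<And>i. i \<ge> L \<Longrightarrow> \<mu> i = 0"
  shows "finite (interlacing \<mu>)"
proof (rule finite_subset)
  show "interlacing \<mu> \<subseteq> {f. \<forall>i. (i \<in> {..<L} \<longrightarrow> f i \<in> {..Max (\<mu> ` {..<L})}) \<and> (i \<notin> {..<L} \<longrightarrow> f i = 0)}"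
  proof (rule subsetI, rule CollectI, intro allI conjI impI)
    fix f i assume f: "f \<in> interlacing \<mu>"
    then have le: "f i \<le> \<mu> i" by (simp add: interlacing_def)
    show "f i \<in> {..Max (\<mu> ` {..<L})}" if "i \<in> {..<L}"
      using le that by (auto intro!: order_trans[OF le] Max_ge)
    show "f i = 0" if "i \<notin> {..<L}" using le that assms[of i] by auto
  qed
  show "finite \<dots>" by (rule finite_set_of_finite_funs) auto
qed

lemma interlacing_support:
  "\<kappa> \<in> interlacing \<mu> \<Longrightarrow> (\<And>i. i \<ge> L \<Longrightarrow> \<mu> i = 0) \<Longrightarrow> i \<ge> L \<Longrightarrow> \<kappa> i = 0"
  by (metis (mono_tags, lifting) interlacing_def le_zero_eq mem_Collect_eq)

text \<open>The Bender--Knuth involution. In a chain \<open>\<nu> \<prec> \<kappa> \<prec> \<mu>\<close> of interlacing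
  sequences, the entries of \<open>\<kappa>\<close> range independently over intervals whose endpoints are determined
  by \<open>\<mu>\<close> and \<open>\<nu>\<close>; reflecting each interval exchanges the sizes of \<open>\<mu>/\<kappa>\<close> and \<open>\<kappa>/\<nu>\<close>.\<close>

definition reflect_middle :: "(nat \<Rightarrow> nat) \<Rightarrow> (nat \<Rightarrow> nat) \<Rightarrow> (nat \<Rightarrow> nat) \<Rightarrow> nat \<Rightarrow> nat" where
  "reflect_middle \<mu> \<nu> \<kappa> i =
     max (\<nu> i) (\<mu> (Suc i)) + (if i = 0 then \<mu> 0 else min (\<mu> i) (\<nu> (i - 1))) - \<kappa> i"

text \<open>The four families of inequalities, sorted by the entry \<open>\<kappa> i\<close> that
  they bound. A bound by \<open>\<nu> (i - 1)\<close> exists only for \<open>i > 0\<close>, hence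
  the case distinction.\<close>

lemma interlacing_chain_iff:
  "\<kappa> \<in> interlacing \<mu> \<and> \<nu> \<in> interlacing \<kappa> \<longleftrightarrow>
   (\<forall>i. max (\<nu> i) (\<mu> (Suc i)) \<le> \<kappa> i \<and> \<kappa> i \<le> (if i = 0 then \<mu> 0 else min (\<mu> i) (\<nu> (i - 1))))"
  (is "?l \<longleftrightarrow> ?r")
proof
  assume ?l
  then have *: "\<mu> (Suc i) \<le> \<kappa> i" "\<kappa> i \<le> \<mu> i" "\<kappa> (Suc i) \<le> \<nu> i" "\<nu> i \<le> \<kappa> i" for i
    by (auto simp: interlacing_def)
  show ?r
  proof
    fix i
    show "max (\<nu> i) (\<mu> (Suc i)) \<le> \<kappa> i \<and> \<kappa> i \<le> (if i = 0 then \<mu> 0 else min (\<mu> i) (\<nu> (i - 1)))"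
      using *[of i] *(3)[of "i - 1"] by auto
  qed
next
  assume r: ?r
  have "\<mu> (Suc i) \<le> \<kappa> i" "\<kappa> i \<le> \<mu> i" "\<kappa> (Suc i) \<le> \<nu> i" "\<nu> i \<le> \<kappa> i" for i
    using r[rule_format, of i] r[rule_format, of "Suc i"] by (auto split: if_splits)
  then show ?l by (auto simp: interlacing_def)
qed

lemma reflect_middle_chain:
  assumes "\<kappa> \<in> interlacing \<mu>" "\<nu> \<in> interlacing \<kappa>"
  shows "reflect_middle \<mu> \<nu> \<kappa> \<in> interlacing \<mu>" "\<nu> \<in> interlacing (reflect_middle \<mu> \<nu> \<kappa>)"
    and "reflect_middle \<mu> \<nu> (reflect_middle \<mu> \<nu> \<kappa>) = \<kappa>"
proof -
  have c: "\<forall>i. max (\<nu> i) (\<mu> (Suc i)) \<le> \<kappa> i \<and>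
      \<kappa> i \<le> (if i = 0 then \<mu> 0 else min (\<mu> i) (\<nu> (i - 1)))"
    using assms interlacing_chain_iff by blast
  have "max (\<nu> i) (\<mu> (Suc i)) \<le> reflect_middle \<mu> \<nu> \<kappa> i \<and>
      reflect_middle \<mu> \<nu> \<kappa> i \<le> (if i = 0 then \<mu> 0 else min (\<mu> i) (\<nu> (i - 1)))" for i
    using c[rule_format, of i] unfolding reflect_middle_def by linarith
  then show "reflect_middle \<mu> \<nu> \<kappa> \<in> interlacing \<mu>" "\<nu> \<in> interlacing (reflect_middle \<mu> \<nu> \<kappa>)"
    using interlacing_chain_iff by blast+
  show "reflect_middle \<mu> \<nu> (reflect_middle \<mu> \<nu> \<kappa>) = \<kappa>"
  proof
    fix i show "reflect_middle \<mu> \<nu> (reflect_middle \<mu> \<nu> \<kappa>) i = \<kappa> i"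
      using c[rule_format, of i] unfolding reflect_middle_def by linarith
  qed
qed

lemma reflect_middle_size:
  assumes ch: "\<kappa> \<in> interlacing \<mu>" "\<nu> \<in> interlacing \<kappa>" and L: "\<And>i. i \<ge> L \<Longrightarrow> \<mu> i = 0"
  shows "(\<Sum>i<L. \<mu> i - reflect_middle \<mu> \<nu> \<kappa> i) = (\<Sum>i<L. \<kappa> i - \<nu> i)"
    and "(\<Sum>i<L. reflect_middle \<mu> \<nu> \<kappa> i - \<nu> i) = (\<Sum>i<L. \<mu> i - \<kappa> i)"
proof -
  let ?\<rho> = "reflect_middle \<mu> \<nu> \<kappa>"
  let ?lo = "\<lambda>i. max (\<nu> i) (\<mu> (Suc i))"
  let ?hi = "\<lambda>i. if i = 0 then \<mu> 0 else min (\<mu> i) (\<nu> (i - 1))"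
  have c: "?lo i \<le> \<kappa> i \<and> \<kappa> i \<le> ?hi i" for i
    using ch interlacing_chain_iff by blast
  \<comment> \<open>The sum telescopes: the lower endpoint at \<open>i\<close> and the upper one at
    \<open>Suc i\<close> are the maximum and the minimum of the same numbers \<open>\<nu> i\<close>
    and \<open>\<mu> (Suc i)\<close>. The boundary term vanishes at \<open>n = L\<close> because
    \<open>\<mu> L = 0\<close>.\<close>
  have lohi: "(\<Sum>i<n. int (?lo i) + int (?hi i)) =
      (\<Sum>i<n. int (\<mu> i) + int (\<nu> i)) + (if n = 0 then 0 else int (\<mu> n) - min (int (\<mu> n)) (int (\<nu> (n - 1))))" for n
    by (induction n) (auto simp: min_def max_def)
  have "int (?\<rho> i) = int (?lo i) + int (?hi i) - int (\<kappa> i)" for i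
    using c[of i] unfolding reflect_middle_def by linarith
  then have "(\<Sum>i<L. int (?\<rho> i)) = (\<Sum>i<L. int (?lo i) + int (?hi i)) - (\<Sum>i<L. int (\<kappa> i))"
    by (simp add: sum_subtractf)
  also have "\<dots> = (\<Sum>i<L. int (\<mu> i)) + (\<Sum>i<L. int (\<nu> i)) - (\<Sum>i<L. int (\<kappa> i))"
    using L[of L] by (simp only: lohi) (simp add: sum.distrib)
  finally have main: "(\<Sum>i<L. int (?\<rho> i)) = (\<Sum>i<L. int (\<mu> i)) + (\<Sum>i<L. int (\<nu> i)) - (\<Sum>i<L. int (\<kappa> i))" .
  have diff: "int (\<Sum>i<L. f i - g i) = (\<Sum>i<L. int (f i)) - (\<Sum>i<L. int (g i))"
    if "g \<in> interlacing f" for f g :: "nat \<Rightarrow> nat"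
    using that by (simp add: interlacing_def of_nat_diff sum_subtractf)
  note r = reflect_middle_chain[OF ch]
  have "int (\<Sum>i<L. \<mu> i - ?\<rho> i) = int (\<Sum>i<L. \<kappa> i - \<nu> i)"
    "int (\<Sum>i<L. ?\<rho> i - \<nu> i) = int (\<Sum>i<L. \<mu> i - \<kappa> i)"
    unfolding diff[OF r(1)] diff[OF r(2)] diff[OF ch(1)] diff[OF ch(2)] main by simp_all
  then show "(\<Sum>i<L. \<mu> i - ?\<rho> i) = (\<Sum>i<L. \<kappa> i - \<nu> i)"
    "(\<Sum>i<L. ?\<rho> i - \<nu> i) = (\<Sum>i<L. \<mu> i - \<kappa> i)"
    by (simp_all only: of_nat_eq_iff)
qed

text \<open>Both sides are sums over chains; reflecting the middle member fixes \<open>\<nu>\<close>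
  and exchanges the exponents of \<open>x\<close> and \<open>y\<close>.\<close>

lemma gt_sum_swap:
  assumes L: "\<And>i. i \<ge> L \<Longrightarrow> \<mu> i = 0"
  shows "gt_sum L \<mu> (x # y # xs) = gt_sum L \<mu> (y # x # xs)"
proof -
  let ?S = "SIGMA \<kappa>:interlacing \<mu>. interlacing \<kappa>"
  have fin: "finite (interlacing \<kappa>)" if "\<kappa> \<in> interlacing \<mu>" for \<kappa>
    using interlacing_support[OF that L] by (rule finite_interlacing)
  have expand: "gt_sum L \<mu> (a # b # xs) = (\<Sum>(\<kappa>, \<nu>)\<in>?S.
      a ^ (\<Sum>i<L. \<mu> i - \<kappa> i) * (b ^ (\<Sum>i<L. \<kappa> i - \<nu> i) * gt_sum L \<nu> xs))" for a b
    using finite_interlacing[OF L] fin by (simp add: sum_distrib_left sum.Sigma)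
  show ?thesis unfolding expand
    by (rule sum.reindex_bij_witness[where
          i = "\<lambda>(\<kappa>, \<nu>). (reflect_middle \<mu> \<nu> \<kappa>, \<nu>)" and j = "\<lambda>(\<kappa>, \<nu>). (reflect_middle \<mu> \<nu> \<kappa>, \<nu>)"])
      (auto simp: reflect_middle_chain reflect_middle_size[OF _ _ L] mult.left_commute)
qed

text \<open>Adjacent swaps carry the last variable to the front.\<close>

lemma gt_sum_move:
  "(\<And>i. i \<ge> L \<Longrightarrow> \<mu> i = 0) \<Longrightarrow> gt_sum L \<mu> (ys @ [x]) = gt_sum L \<mu> (x # ys)"
proof (induction ys arbitrary: \<mu>)
  case (Cons y ys)
  have "gt_sum L \<mu> ((y # ys) @ [x]) = gt_sum L \<mu> (y # x # ys)"
    using Cons.IH interlacing_support[OF _ Cons.prems] by simp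
  also have "\<dots> = gt_sum L \<mu> (x # y # ys)"
    by (rule gt_sum_swap) (fact Cons.prems)
  finally show ?case .
qed simp

lemma gt_sum_rev:
  "(\<And>i. i \<ge> L \<Longrightarrow> \<mu> i = 0) \<Longrightarrow> gt_sum L \<mu> (rev xs) = gt_sum L \<mu> xs"
proof (induction xs arbitrary: \<mu>)
  case (Cons x xs)
  have "gt_sum L \<mu> (rev (x # xs)) = gt_sum L \<mu> (x # rev xs)"
    using gt_sum_move[OF Cons.prems] by simp
  also have "\<dots> = gt_sum L \<mu> (x # xs)"
    using Cons.IH interlacing_support[OF _ Cons.prems] by simp
  finally show ?case .
qed simp

section \<open>Tableaux as Gelfand--Tsetlin patterns\<close>

definition row_less :: "nat \<times> nat \<Rightarrow> nat \<times> nat \<Rightarrow> bool" where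
  "row_less a b \<longleftrightarrow> fst a = fst b \<and> snd a < snd b"

definition col_less :: "nat \<times> nat \<Rightarrow> nat \<times> nat \<Rightarrow> bool" where
  "col_less a b \<longleftrightarrow> snd a = snd b \<and> fst a < fst b"

definition cells :: "(nat \<Rightarrow> nat) \<Rightarrow> (nat \<times> nat) set" where
  "cells \<mu> = {(i, j). j < \<mu> i}"

lemma cells_Sigma:
  assumes "\<And>i. i \<ge> L \<Longrightarrow> \<mu> i = 0"
  shows "cells \<mu> = (SIGMA i:{..<L}. {..<\<mu> i})"
  using assms by (force simp: cells_def not_less[symmetric])

lemma finite_cells: "(\<And>i. i \<ge> L \<Longrightarrow> \<mu> i = 0) \<Longrightarrow> finite (cells \<mu>)"
  by (subst cells_Sigma[of L \<mu>]) auto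

lemma card_cells: "(\<And>i. i \<ge> L \<Longrightarrow> \<mu> i = 0) \<Longrightarrow> card (cells \<mu>) = (\<Sum>i<L. \<mu> i)"
  by (subst cells_Sigma[of L \<mu>]) auto

lemma inj_cells: "inj cells"
proof
  fix \<kappa> \<mu> assume "cells \<kappa> = cells \<mu>"
  then have "j < \<kappa> i \<longleftrightarrow> j < \<mu> i" for i j by (auto simp: cells_def set_eq_iff)
  then show "\<kappa> = \<mu>" by (metis ext linorder_neqE_nat order_less_irrefl)
qed

lemma interlacing_antimono: "\<kappa> \<in> interlacing \<mu> \<Longrightarrow> \<kappa> (Suc i) \<le> \<kappa> i"
  unfolding interlacing_def by (auto intro: order_trans)

text \<open>Closure under \<open>row_less\<close> makes a top set a final segment of each row, and
  the remaining row lengths form \<open>\<kappa>\<close>. That no cell of the set has a cell of the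
  diagram below it means \<open>\<mu> (Suc i) \<le> \<kappa> i\<close>.\<close>

lemma bij_betw_interlacing_top_sets:
  assumes anti: "\<And>i. \<mu> (Suc i) \<le> \<mu> i"
  shows "bij_betw (\<lambda>\<kappa>. cells \<mu> - cells \<kappa>) (interlacing \<mu>) (top_sets row_less col_less (cells \<mu>))"
proof (rule bij_betw_imageI)
  have sub: "cells \<kappa> \<subseteq> cells \<mu>" if "\<kappa> \<in> interlacing \<mu>" for \<kappa>
    using that unfolding cells_def interlacing_def by (auto intro: less_le_trans)
  show "inj_on (\<lambda>\<kappa>. cells \<mu> - cells \<kappa>) (interlacing \<mu>)"
    by (rule inj_onI) (metis double_diff sub inj_cells injD subset_refl)
  have mono: "\<mu> j \<le> \<mu> i" if "i \<le> j" for i j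
    using lift_Suc_antimono_le[of \<mu>] anti that by blast
  show "(\<lambda>\<kappa>. cells \<mu> - cells \<kappa>) ` interlacing \<mu> = top_sets row_less col_less (cells \<mu>)"
  proof (intro equalityI subsetI)
    fix X assume "X \<in> (\<lambda>\<kappa>. cells \<mu> - cells \<kappa>) ` interlacing \<mu>"
    then obtain \<kappa> where \<kappa>: "\<kappa> \<in> interlacing \<mu>" "X = cells \<mu> - cells \<kappa>" by auto
    have "\<not> (j < \<mu> i')" if "\<kappa> i \<le> j" "i < i'" for i i' j
    proof -
      have "\<mu> i' \<le> \<mu> (Suc i)" "\<mu> (Suc i) \<le> \<kappa> i"
        using mono[of "Suc i" i'] \<kappa>(1) that by (auto simp: interlacing_def)
      then show ?thesis using that by linarith
    qed
    then show "X \<in> top_sets row_less col_less (cells \<mu>)"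
      by (fastforce simp: \<kappa>(2) top_sets_def cells_def row_less_def col_less_def not_less)
  next
    fix X assume "X \<in> top_sets row_less col_less (cells \<mu>)"
    then have X: "X \<subseteq> cells \<mu>"
      and row: "\<And>i j j'. (i, j) \<in> X \<Longrightarrow> j < j' \<Longrightarrow> j' < \<mu> i \<Longrightarrow> (i, j') \<in> X"
      and col: "\<And>i i' j. (i, j) \<in> X \<Longrightarrow> i < i' \<Longrightarrow> \<not> j < \<mu> i'"
      by (fastforce simp: top_sets_def row_less_def col_less_def cells_def)+
    \<comment> \<open>The column where the part of \<open>X\<close> in row \<open>i\<close> begins;
      \<open>j = \<mu> i\<close> is the default for rows that miss \<open>X\<close>.\<close>
    define \<kappa> where "\<kappa> i = (LEAST j. j = \<mu> i \<or> (i, j) \<in> X)" for i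
    have \<kappa>: "\<kappa> i = \<mu> i \<or> (i, \<kappa> i) \<in> X" for i
      unfolding \<kappa>_def by (rule LeastI[where k = "\<mu> i"]) simp
    have \<kappa>_le: "\<kappa> i \<le> j" if "j = \<mu> i \<or> (i, j) \<in> X" for i j
      unfolding \<kappa>_def using that by (rule Least_le)
    have in_X: "(i, j) \<in> X \<longleftrightarrow> \<kappa> i \<le> j \<and> j < \<mu> i" for i j
      using \<kappa>[of i] \<kappa>_le[of j i] row[of i "\<kappa> i" j] X by (auto simp: cells_def le_less)
    have "\<mu> (Suc i) \<le> \<kappa> i" for i
      using \<kappa>[of i] col[of i "\<kappa> i" "Suc i"] anti[of i] by force
    then have "\<kappa> \<in> interlacing \<mu>"
      using \<kappa>_le by (simp add: interlacing_def)
    moreover have "X = cells \<mu> - cells \<kappa>"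
      using in_X by (auto simp: cells_def not_less)
    ultimately show "X \<in> (\<lambda>\<kappa>. cells \<mu> - cells \<kappa>) ` interlacing \<mu>" by blast
  qed
qed

text \<open>The branching rule: the cells with the largest entry form a horizontal strip, whose
  removal leaves \<open>cells \<kappa>\<close>. As the largest entry is removed first, the variables
  are listed in reverse order.\<close>

lemma filling_sum_eq_gt_sum:
  assumes "\<And>i. \<mu> (Suc i) \<le> \<mu> i" "\<And>i. i \<ge> L \<Longrightarrow> \<mu> i = 0"
  shows "filling_sum row_less col_less (cells \<mu>) n x = gt_sum L \<mu> (map x (rev [0..<n]))"
  using assms
proof (induction n arbitrary: \<mu>)
  case 0
  have "cells \<mu> = {} \<longleftrightarrow> \<mu> = (\<lambda>_. 0)" by (auto simp: cells_def fun_eq_iff)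
  then show ?case by (cases "cells \<mu> = {}") (simp_all add: filling_sum_0)
next
  case (Suc n)
  note L = Suc.prems(2)
  have "filling_sum row_less col_less (cells \<mu>) (Suc n) x =
     (\<Sum>X\<in>top_sets row_less col_less (cells \<mu>).
        x n ^ card X * filling_sum row_less col_less (cells \<mu> - X) n x)"
    by (rule filling_sum_Suc) (rule finite_cells[OF L])
  also have "\<dots> = (\<Sum>\<kappa>\<in>interlacing \<mu>. x n ^ card (cells \<mu> - cells \<kappa>) *
      filling_sum row_less col_less (cells \<mu> - (cells \<mu> - cells \<kappa>)) n x)"
    by (rule sum.reindex_bij_betw[OF bij_betw_interlacing_top_sets, symmetric]) (rule Suc.prems(1))
  also have "\<dots> = (\<Sum>\<kappa>\<in>interlacing \<mu>. x n ^ (\<Sum>i<L. \<mu> i - \<kappa> i) * gt_sum L \<kappa> (map x (rev [0..<n])))"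
  proof (rule sum.cong[OF refl])
    fix \<kappa> assume \<kappa>: "\<kappa> \<in> interlacing \<mu>"
    then have le: "\<And>i. \<kappa> i \<le> \<mu> i" by (simp add: interlacing_def)
    then have sub: "cells \<kappa> \<subseteq> cells \<mu>"
      unfolding cells_def by (auto intro: less_le_trans)
    have L': "\<And>i. i \<ge> L \<Longrightarrow> \<kappa> i = 0" using interlacing_support[OF \<kappa> L] by blast
    have IH: "filling_sum row_less col_less (cells \<kappa>) n x = gt_sum L \<kappa> (map x (rev [0..<n]))"
      by (rule Suc.IH) (use interlacing_antimono[OF \<kappa>] L' in auto)
    have "card (cells \<mu> - cells \<kappa>) = (\<Sum>i<L. \<mu> i) - (\<Sum>i<L. \<kappa> i)"
      using sub by (simp add: card_Diff_subset finite_cells[OF L'] card_cells[OF L] card_cells[OF L'])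
    also have "\<dots> = (\<Sum>i<L. \<mu> i - \<kappa> i)" using le by (simp add: sum_subtractf_nat)
    finally show "x n ^ card (cells \<mu> - cells \<kappa>) *
        filling_sum row_less col_less (cells \<mu> - (cells \<mu> - cells \<kappa>)) n x =
        x n ^ (\<Sum>i<L. \<mu> i - \<kappa> i) * gt_sum L \<kappa> (map x (rev [0..<n]))"
      using IH sub by (simp add: double_diff)
  qed
  also have "\<dots> = gt_sum L \<mu> (map x (rev [0..<Suc n]))" by simp
  finally show ?case .
qed

lemma schur_eq_filling_sum:
  "schur \<mu> n x = filling_sum row_less col_less (young_diagram \<mu>) n x"
proof -
  have "semistandard_tableaux \<mu> n = fillings row_less col_less (young_diagram \<mu>) n"
    unfolding semistandard_tableaux_def fillings_def row_less_def col_less_def by fastforce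
  then show ?thesis by (simp add: schur_def filling_sum_def)
qed

lemma young_diagram_eq_cells:
  "young_diagram \<mu> = cells (\<lambda>i. if i < length \<mu> then \<mu> ! i else 0)"
  by (auto simp: young_diagram_def cells_def split: if_splits)

lemma finite_young_diagram: "finite (young_diagram \<mu>)"
  unfolding young_diagram_eq_cells by (rule finite_cells[of "length \<mu>"]) simp

lemma card_young_diagram:
  assumes "partition_of w \<mu>"
  shows "card (young_diagram \<mu>) = w"
proof -
  have "card (young_diagram \<mu>) = (\<Sum>i<length \<mu>. if i < length \<mu> then \<mu> ! i else 0)"
    unfolding young_diagram_eq_cells by (rule card_cells) simp
  also have "\<dots> = sum_list \<mu>" by (simp add: sum_list_sum_nth atLeast0LessThan)
  finally show ?thesis using assms by (simp add: partition_of_def)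
qed

lemma schur_reverse:
  assumes "partition_of w \<mu>"
  shows "schur \<mu> n (\<lambda>i. x (n - 1 - i)) = schur \<mu> n x"
proof -
  let ?\<mu> = "\<lambda>i. if i < length \<mu> then \<mu> ! i else 0"
  have anti: "?\<mu> (Suc i) \<le> ?\<mu> i" for i
    using assms by (auto simp: partition_of_def sorted_wrt_iff_nth_less)
  have "map (\<lambda>i. x (n - 1 - i)) (rev [0..<n]) = rev (map x (rev [0..<n]))"
    by (rule nth_equalityI) (auto simp: rev_nth)
  moreover have "filling_sum row_less col_less (cells ?\<mu>) n y = gt_sum (length \<mu>) ?\<mu> (map y (rev [0..<n]))"
    for y :: "nat \<Rightarrow> 'a"
    by (rule filling_sum_eq_gt_sum) (use anti in auto)
  moreover have "gt_sum (length \<mu>) ?\<mu> (rev (map x (rev [0..<n]))) = gt_sum (length \<mu>) ?\<mu> (map x (rev [0..<n]))"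
    by (rule gt_sum_rev) simp
  ultimately show ?thesis
    unfolding schur_eq_filling_sum young_diagram_eq_cells by metis
qed

section \<open>Coefficients with respect to quantum integers\<close>

definition qpow :: "int \<Rightarrow> rat fls" where
  "qpow i = fls_X powi i"

lemma qpow_nth: "qpow i $$ n = (if n = i then 1 else 0)"
  by (auto simp: qpow_def)

lemma qpow_0 [simp]: "qpow 0 = 1"
  by (simp add: qpow_def)

lemma qpow_add: "qpow (i + j) = qpow i * qpow j"
  unfolding qpow_def by (rule power_int_add) simp

lemma qpow_power: "qpow i ^ n = qpow (i * int n)"
  unfolding qpow_def by (simp only: power_int_mult power_int_of_nat)

lemma qpow_prod: "(\<Prod>c\<in>C. qpow (f c)) = qpow (\<Sum>c\<in>C. f c)"
  by (induction C rule: infinite_finite_induct) (simp_all add: qpow_add)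

lemma qpow_times_nth: "(qpow i * f) $$ n = f $$ (n - i)"
  by (simp add: qpow_def fls_X_intpow_times_conv_shift)

lemma q_int_qpow: "q_int k = (qpow (int k) - qpow (- int k)) / (qpow 1 - qpow (-1))"
  by (simp add: q_int_def qpow_def)

lemma qpow_diff_nonzero: "qpow 1 - qpow (-1) \<noteq> 0"
proof
  assume "qpow 1 - qpow (-1) = 0"
  then have "(qpow 1 - qpow (-1)) $$ 1 = 0" by simp
  then show False by (simp add: qpow_nth)
qed

text \<open>The nonzero element \<open>q - q^-1\<close> turns \<open>q_int k\<close> into
  \<open>q^k - q^-k\<close>, so the product has coefficient \<open>a k\<close> at \<open>q^k\<close>
  and its negative at \<open>q^-k\<close>. Laurent series form a field, so multiplying by this
  element loses nothing.\<close>

lemma eq_q_int_sum_iff: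
  fixes a :: "nat \<Rightarrow> int"
  assumes "a 0 = 0" "finite {k. a k \<noteq> 0}"
  shows "f = (\<Sum>k | a k \<noteq> 0. of_int (a k) * q_int k) \<longleftrightarrow>
    (\<forall>n. ((qpow 1 - qpow (-1)) * f) $$ n =
      (if n \<ge> 0 then of_int (a (nat n)) else - of_int (a (nat (- n)))))"
proof -
  let ?d = "qpow 1 - qpow (-1)" and ?S = "{k. a k \<noteq> 0}"
  let ?g = "\<Sum>k | a k \<noteq> 0. of_int (a k) * q_int k"
  have "?d * ?g = (\<Sum>k | a k \<noteq> 0. of_int (a k) * (qpow (int k) - qpow (- int k)))"
    unfolding sum_distrib_left using qpow_diff_nonzero by (simp add: q_int_qpow)
  then have nth: "(?d * ?g) $$ n =
      (\<Sum>k\<in>?S. rat_of_int (a k) * ((if n = int k then 1 else 0) - (if n = - int k then 1 else 0)))" for n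
    by (simp add: fls_nth_sum fls_of_int qpow_nth)
  have val: "(?d * ?g) $$ n = (if n \<ge> 0 then of_int (a (nat n)) else - of_int (a (nat (- n))))" for n
  proof -
    consider "n > 0" | "n = 0" | "n < 0" by linarith
    then show ?thesis
    proof cases
      case 1
      then have "(?d * ?g) $$ n = (\<Sum>k\<in>?S. if k = nat n then rat_of_int (a k) else 0)"
        unfolding nth by (intro sum.cong) auto
      then show ?thesis using 1 assms(2) by (simp add: sum.delta)
    next
      case 2
      have "(?d * ?g) $$ n = 0"
        unfolding nth using 2 by (intro sum.neutral) auto
      then show ?thesis using 2 assms(1) by simp
    next
      case 3
      then have "(?d * ?g) $$ n = (\<Sum>k\<in>?S. if k = nat (- n) then - rat_of_int (a k) else 0)"
        unfolding nth by (intro sum.cong) auto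
      then show ?thesis using 3 assms(2) by (simp add: sum.delta)
    qed
  qed
  have "f = ?g \<longleftrightarrow> ?d * f = ?d * ?g"
    using qpow_diff_nonzero by simp
  also have "\<dots> \<longleftrightarrow> (\<forall>n. (?d * f) $$ n = (?d * ?g) $$ n)"
    unfolding fls_eq_iff ..
  finally show ?thesis unfolding val .
qed

lemma schur_spec_qpow:
  "schur_spec \<mu> h =
    (\<Sum>T\<in>semistandard_tableaux \<mu> (h + 1). qpow (\<Sum>c\<in>young_diagram \<mu>. 2 * int (T c) - int h))"
  unfolding schur_spec_def schur_def qpow_def[symmetric] qpow_prod ..

text \<open>Replacing the index \<open>i\<close> of a variable by \<open>h - i\<close> inverts
  \<open>q^(2i-h)\<close>, and by \<open>schur_reverse\<close> this does not change the
  value.\<close>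

lemma schur_spec_symmetric:
  assumes "partition_of w \<mu>"
  shows "schur_spec \<mu> h $$ (- n) = schur_spec \<mu> h $$ n"
proof -
  let ?e = "\<lambda>T. \<Sum>c\<in>young_diagram \<mu>. 2 * int (T c) - int h"
  have "schur_spec \<mu> h = schur \<mu> (h + 1) (\<lambda>i. qpow (2 * int (h + 1 - 1 - i) - int h))"
    unfolding schur_spec_def qpow_def[symmetric] by (rule schur_reverse[OF assms, symmetric])
  also have "\<dots> = (\<Sum>T\<in>semistandard_tableaux \<mu> (h + 1). qpow (- ?e T))"
    unfolding schur_def qpow_prod
  proof (intro sum.cong refl)
    fix T assume "T \<in> semistandard_tableaux \<mu> (h + 1)"
    then have "T \<in> young_diagram \<mu> \<rightarrow> {..<h + 1}"
      by (simp add: semistandard_tableaux_def PiE_def)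
    then have "T c \<le> h" if "c \<in> young_diagram \<mu>" for c
      using that by (auto dest: funcset_mem simp: less_Suc_eq_le)
    then have "(\<Sum>c\<in>young_diagram \<mu>. 2 * int (h + 1 - 1 - T c) - int h) = - ?e T"
      unfolding sum_negf[symmetric] by (intro sum.cong) (auto simp: of_nat_diff)
    then show "qpow (\<Sum>c\<in>young_diagram \<mu>. 2 * int (h + 1 - 1 - T c) - int h) = qpow (- ?e T)"
      by simp
  qed
  finally have "schur_spec \<mu> h $$ (- n) =
      (\<Sum>T\<in>semistandard_tableaux \<mu> (h + 1). qpow (- ?e T)) $$ (- n)"
    by simp
  also have "\<dots> = (\<Sum>T\<in>semistandard_tableaux \<mu> (h + 1). qpow (?e T)) $$ n"
    by (simp add: fls_nth_sum qpow_nth)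
  finally show ?thesis unfolding schur_spec_qpow .
qed

lemma schur_spec_bounded:
  "\<exists>M. \<forall>n. schur_spec \<mu> h $$ n \<noteq> 0 \<longrightarrow> \<bar>n\<bar> \<le> M"
proof -
  let ?e = "\<lambda>T. \<Sum>c\<in>young_diagram \<mu>. 2 * int (T c) - int h"
  let ?S = "semistandard_tableaux \<mu> (h + 1)"
  have fin: "finite ?S"
    unfolding semistandard_tableaux_def
    by (rule finite_subset[OF _ finite_PiE[OF finite_young_diagram[of \<mu>], of "\<lambda>_. {..<h + 1}"]]) auto
  have "\<bar>n\<bar> \<le> (\<Sum>T\<in>?S. \<bar>?e T\<bar>)" if "schur_spec \<mu> h $$ n \<noteq> 0" for n
  proof -
    have "\<exists>T\<in>?S. qpow (?e T) $$ n \<noteq> 0"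
      using that unfolding schur_spec_qpow fls_nth_sum by (rule contrapos_np) (auto intro: sum.neutral)
    then obtain T where "T \<in> ?S" "n = ?e T" by (auto simp: qpow_nth split: if_splits)
    then show ?thesis using member_le_sum[of T ?S "\<lambda>T. \<bar>?e T\<bar>"] fin by auto
  qed
  then show ?thesis by blast
qed

lemma schur_spec_integral: "\<exists>N. schur_spec \<mu> h $$ n = rat_of_int N"
proof
  show "schur_spec \<mu> h $$ n = rat_of_int (\<Sum>T\<in>semistandard_tableaux \<mu> (h + 1).
      if n = (\<Sum>c\<in>young_diagram \<mu>. 2 * int (T c) - int h) then 1 else 0)"
    unfolding schur_spec_qpow fls_nth_sum of_int_sum qpow_nth by (intro sum.cong) auto
qed

text \<open>The description in \<open>schur_coeff\<close> has exactly one solution, given by the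
  coefficients of the product with \<open>q - q^-1\<close>. They are integers, almost all zero, and
  antisymmetric because \<open>schur_spec\<close> is symmetric and \<open>q - q^-1\<close> changes
  sign under \<open>q\<close> to \<open>q^-1\<close>.\<close>

lemma schur_coeff_eq:
  assumes "partition_of w \<mu>"
  shows "rat_of_int (schur_coeff \<mu> h k) = ((qpow 1 - qpow (-1)) * schur_spec \<mu> h) $$ int k"
proof -
  let ?f = "schur_spec \<mu> h" and ?d = "qpow 1 - qpow (-1)"
  have nth: "(?d * ?f) $$ n = ?f $$ (n - 1) - ?f $$ (n + 1)" for n
    by (simp add: left_diff_distrib qpow_times_nth)
  have "\<exists>c. (?d * ?f) $$ n = rat_of_int c" for n
    unfolding nth using schur_spec_integral by (metis of_int_diff)
  then obtain c where c: "\<And>n. (?d * ?f) $$ n = rat_of_int (c n)" by metis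
  have odd: "c (- n) = - c n" for n
  proof -
    have "?f $$ (- n - 1) = ?f $$ (n + 1)" "?f $$ (- n + 1) = ?f $$ (n - 1)"
      using schur_spec_symmetric[OF assms, of h "n + 1"] schur_spec_symmetric[OF assms, of h "n - 1"]
      by simp_all
    then have "rat_of_int (c (- n)) = rat_of_int (- c n)"
      unfolding of_int_minus c[symmetric] nth by simp
    then show ?thesis by (simp only: of_int_eq_iff)
  qed
  have c0: "c 0 = 0" using odd[of 0] by simp
  obtain M where M: "\<And>n. ?f $$ n \<noteq> 0 \<Longrightarrow> \<bar>n\<bar> \<le> M" using schur_spec_bounded by blast
  have "k \<in> {..nat (M + 1)}" if "c (int k) \<noteq> 0" for k
  proof -
    have "?f $$ (int k - 1) \<noteq> 0 \<or> ?f $$ (int k + 1) \<noteq> 0"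
      using that c[of "int k"] unfolding nth by (metis diff_self of_int_0_eq_iff)
    then show ?thesis using M[of "int k - 1"] M[of "int k + 1"] by auto
  qed
  then have fin: "finite {k. c (int k) \<noteq> 0}"
    by (intro finite_subset[OF subsetI finite_atMost[of "nat (M + 1)"]]) simp
  let ?P = "\<lambda>a :: nat \<Rightarrow> int. a 0 = 0 \<and> finite {k. a k \<noteq> 0} \<and> ?f = (\<Sum>k | a k \<noteq> 0. of_int (a k) * q_int k)"
  have P_iff: "?P a \<longleftrightarrow> a = (\<lambda>k. c (int k))" for a
  proof
    assume a: "?P a"
    then have "\<forall>n. (?d * ?f) $$ n = (if n \<ge> 0 then of_int (a (nat n)) else - of_int (a (nat (- n))))"
      using eq_q_int_sum_iff[of a ?f] by blast
    then have "rat_of_int (c (int k)) = rat_of_int (a k)" for k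
      unfolding c by (metis nat_int of_nat_0_le_iff)
    then show "a = (\<lambda>k. c (int k))" by auto
  next
    assume a: "a = (\<lambda>k. c (int k))"
    have "(?d * ?f) $$ n = (if n \<ge> 0 then of_int (a (nat n)) else - of_int (a (nat (- n))))" for n
      unfolding c a using odd[of n] by simp
    moreover have "a 0 = 0" "finite {k. a k \<noteq> 0}" using c0 fin a by simp_all
    ultimately show "?P a" using eq_q_int_sum_iff[of a ?f] by blast
  qed
  have "schur_coeff \<mu> h = (\<lambda>k. c (int k))"
    unfolding schur_coeff_def P_iff by simp
  then show ?thesis by (simp add: c)
qed

section \<open>Positive parts of rational series\<close>

lemma fls_mult_nth_nonzero:
  fixes f g :: "'a::semiring_0 fls"
  assumes "(f * g) $$ n \<noteq> 0"
  obtains i where "f $$ i \<noteq> 0" "g $$ (n - i) \<noteq> 0"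
proof -
  have "\<exists>i. f $$ i * g $$ (n - i) \<noteq> 0"
    using assms unfolding fls_times_nth(2) by (rule contrapos_np) (auto intro: sum.neutral)
  then show ?thesis using that by (metis mult_zero_left mult_zero_right)
qed

lemma fps_fls_mult_nth_nonzero:
  fixes F G :: "'a::semiring_0 fls fps"
  assumes "(F * G) $ h $$ n \<noteq> 0"
  obtains i m where "i \<le> h" "F $ i $$ m \<noteq> 0" "G $ (h - i) $$ (n - m) \<noteq> 0"
proof -
  have "\<exists>i\<in>{0..h}. (F $ i * G $ (h - i)) $$ n \<noteq> 0"
    using assms unfolding fps_mult_nth fls_nth_sum
    by (rule contrapos_np) (auto intro: sum.neutral)
  then obtain i where i: "i \<le> h" "(F $ i * G $ (h - i)) $$ n \<noteq> 0" by auto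
  show ?thesis using fls_mult_nth_nonzero[OF i(2)] that[OF i(1)] by blast
qed

text \<open>The ring \<open>Q[q, q^-1][z]\<close>; one bound \<open>M\<close> controls both
  exponents.\<close>

definition laurent_zq :: "rat fls fps set" where
  "laurent_zq = {F. \<exists>M. \<forall>h n. F $ h $$ n \<noteq> 0 \<longrightarrow> int h \<le> M \<and> \<bar>n\<bar> \<le> M}"

lemma laurent_zqI:
  "(\<And>h n. F $ h $$ n \<noteq> 0 \<Longrightarrow> int h \<le> M \<and> \<bar>n\<bar> \<le> M) \<Longrightarrow> F \<in> laurent_zq"
  by (auto simp: laurent_zq_def)

lemma laurent_zq_const_monom: "fps_const (qpow i) * fps_X ^ j \<in> laurent_zq"
  by (rule laurent_zqI[of _ "max (int j) \<bar>i\<bar>"])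
    (auto simp: fps_X_power_mult_right_nth qpow_nth split: if_splits)

lemma laurent_zq_0 [intro]: "0 \<in> laurent_zq"
  by (rule laurent_zqI[of _ 0]) simp

lemma laurent_zq_1 [intro]: "1 \<in> laurent_zq"
  using laurent_zq_const_monom[of 0 0] by simp

lemma laurent_zq_add [intro]:
  assumes "F \<in> laurent_zq" "G \<in> laurent_zq"
  shows "F + G \<in> laurent_zq"
proof -
  obtain M where M: "\<And>h n. F $ h $$ n \<noteq> 0 \<Longrightarrow> int h \<le> M \<and> \<bar>n\<bar> \<le> M"
    using assms(1) by (auto simp: laurent_zq_def)
  obtain M' where M': "\<And>h n. G $ h $$ n \<noteq> 0 \<Longrightarrow> int h \<le> M' \<and> \<bar>n\<bar> \<le> M'"
    using assms(2) by (auto simp: laurent_zq_def)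
  show ?thesis
  proof (rule laurent_zqI[of _ "max M M'"])
    fix h n assume "(F + G) $ h $$ n \<noteq> 0"
    then have "F $ h $$ n \<noteq> 0 \<or> G $ h $$ n \<noteq> 0" by auto
    then show "int h \<le> max M M' \<and> \<bar>n\<bar> \<le> max M M'" using M[of h n] M'[of h n] by auto
  qed
qed

lemma laurent_zq_mult [intro]:
  assumes "F \<in> laurent_zq" "G \<in> laurent_zq"
  shows "F * G \<in> laurent_zq"
proof -
  obtain M where M: "\<And>h n. F $ h $$ n \<noteq> 0 \<Longrightarrow> int h \<le> M \<and> \<bar>n\<bar> \<le> M"
    using assms(1) by (auto simp: laurent_zq_def)
  obtain M' where M': "\<And>h n. G $ h $$ n \<noteq> 0 \<Longrightarrow> int h \<le> M' \<and> \<bar>n\<bar> \<le> M'"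
    using assms(2) by (auto simp: laurent_zq_def)
  show ?thesis
  proof (rule laurent_zqI[of _ "M + M'"])
    fix h n assume "(F * G) $ h $$ n \<noteq> 0"
    then obtain i m where "i \<le> h" "F $ i $$ m \<noteq> 0" "G $ (h - i) $$ (n - m) \<noteq> 0"
      by (rule fps_fls_mult_nth_nonzero)
    then show "int h \<le> M + M' \<and> \<bar>n\<bar> \<le> M + M'"
      using M[of i m] M'[of "h - i" "n - m"] by auto
  qed
qed

lemma laurent_zq_uminus: "F \<in> laurent_zq \<Longrightarrow> - F \<in> laurent_zq"
  by (simp add: laurent_zq_def)

lemma laurent_zq_diff [intro]: "F \<in> laurent_zq \<Longrightarrow> G \<in> laurent_zq \<Longrightarrow> F - G \<in> laurent_zq"
  unfolding diff_conv_add_uminus by (intro laurent_zq_add laurent_zq_uminus)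

lemma laurent_zq_power [intro]: "F \<in> laurent_zq \<Longrightarrow> F ^ n \<in> laurent_zq"
  by (induction n) auto

lemma laurent_zq_sum [intro]: "(\<And>i. i \<in> I \<Longrightarrow> F i \<in> laurent_zq) \<Longrightarrow> sum F I \<in> laurent_zq"
  by (induction I rule: infinite_finite_induct) auto

lemma laurent_zq_prod [intro]: "(\<And>i. i \<in> I \<Longrightarrow> F i \<in> laurent_zq) \<Longrightarrow> prod F I \<in> laurent_zq"
  by (induction I rule: infinite_finite_induct) auto

lemma laurent_zq_X_power [intro]: "fps_X ^ j \<in> laurent_zq"
  using laurent_zq_const_monom[of 0 j] by simp

section \<open>Linear factors, their inverses and the growth of exponents\<close>

definition lin :: "int \<Rightarrow> rat fls fps" where
  "lin j = 1 - fps_const (qpow j) * fps_X"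

text \<open>The expansion of \<open>1 / (1 - q^j z)\<close> in powers of \<open>z\<close>.\<close>

definition geo :: "int \<Rightarrow> rat fls fps" where
  "geo j = Abs_fps (\<lambda>h. qpow (j * int h))"

lemma laurent_zq_lin [intro]: "lin j \<in> laurent_zq"
  unfolding lin_def using laurent_zq_const_monom[of j 1] by auto

lemma lin_geo: "lin j * geo j = 1"
proof (rule fps_ext)
  fix n
  show "(lin j * geo j) $ n = 1 $ n"
    by (cases n) (simp_all add: lin_def geo_def left_diff_distrib mult.assoc qpow_add algebra_simps)
qed

text \<open>For \<open>e = 1\<close> (resp. \<open>e = -1\<close>) the coefficient of \<open>z\<^sup>h\<close> only involves powers of \<open>q\<close> with
  exponent at least \<open>h - c\<close> (resp. at most \<open>c - h\<close>).\<close>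

definition grows :: "int \<Rightarrow> int \<Rightarrow> rat fls fps \<Rightarrow> bool" where
  "grows e c F \<longleftrightarrow> (\<forall>h n. F $ h $$ n \<noteq> 0 \<longrightarrow> e * n \<ge> int h - c)"

lemma grows_mult:
  assumes "grows e c F" "grows e c' G"
  shows "grows e (c + c') (F * G)"
  unfolding grows_def
proof (intro allI impI)
  fix h n assume "(F * G) $ h $$ n \<noteq> 0"
  then obtain i m where *: "i \<le> h" "F $ i $$ m \<noteq> 0" "G $ (h - i) $$ (n - m) \<noteq> 0"
    by (rule fps_fls_mult_nth_nonzero)
  then have "e * m \<ge> int i - c" "e * (n - m) \<ge> int (h - i) - c'"
    using assms unfolding grows_def by blast+
  then show "e * n \<ge> int h - (c + c')" using *(1) by (simp add: algebra_simps)
qed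

lemma grows_prod:
  assumes "\<And>i. i \<in> I \<Longrightarrow> grows e 0 (F i)"
  shows "grows e 0 (prod F I)"
  using assms
proof (induction I rule: infinite_finite_induct)
  case (insert x I)
  then show ?case using grows_mult[of e 0 "F x" 0 "prod F I"] by simp
qed (auto simp: grows_def)

lemma grows_geo: "e * j \<ge> 1 \<Longrightarrow> grows e 0 (geo j)"
  unfolding grows_def geo_def
  by (auto simp: qpow_nth mult.assoc[symmetric] mult_le_cancel_right1 split: if_splits)

text \<open>On a support bounded by \<open>M\<close> both \<open>h \<le> M\<close> and
  \<open>e * n \<ge> - M\<close> hold, so \<open>c = 2 * M\<close> works.\<close>

lemma laurent_zq_grows:
  assumes "F \<in> laurent_zq" "\<bar>e\<bar> = 1"
  shows "\<exists>c. grows e c F"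
proof -
  obtain M where M: "\<And>h n. F $ h $$ n \<noteq> 0 \<Longrightarrow> int h \<le> M \<and> \<bar>n\<bar> \<le> M"
    using assms(1) by (auto simp: laurent_zq_def)
  have "e * n \<ge> int h - 2 * M" if "F $ h $$ n \<noteq> 0" for h n
  proof -
    have "e = 1 \<or> e = - 1" using assms(2) by linarith
    then show ?thesis using M[OF that] by auto
  qed
  then show ?thesis unfolding grows_def by blast
qed

definition pos_part :: "rat fls \<Rightarrow> rat fls" where
  "pos_part f = fps_to_fls (Abs_fps (\<lambda>k. if k \<ge> 1 then f $$ int k else 0))"

lemma pos_part_nth: "pos_part f $$ n = (if n \<ge> 1 then f $$ n else 0)"
  by (auto simp: pos_part_def)

definition pos_series :: "rat fls fps \<Rightarrow> rat fls fps" where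
  "pos_series F = Abs_fps (\<lambda>h. pos_part (F $ h))"

lemma pos_series_nth: "pos_series F $ h $$ n = (if n \<ge> 1 then F $ h $$ n else 0)"
  by (simp add: pos_series_def pos_part_nth)

lemma pos_series_add: "pos_series (F + G) = pos_series F + pos_series G"
  by (intro fps_ext fls_eqI) (simp add: pos_series_nth)

definition q_free :: "rat fls fps \<Rightarrow> bool" where
  "q_free F \<longleftrightarrow> (\<forall>h. \<exists>c. F $ h = fls_const c)"

text \<open>A series in \<open>z\<close> alone multiplies without moving exponents of
  \<open>q\<close>.\<close>

lemma pos_series_mult_q_free:
  assumes "q_free C"
  shows "pos_series (C * F) = C * pos_series F"
proof (intro fps_ext fls_eqI)
  fix h n
  obtain c where c: "\<And>h. C $ h = fls_const (c h)" using assms by (metis q_free_def)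
  show "pos_series (C * F) $ h $$ n = (C * pos_series F) $ h $$ n"
    by (simp add: pos_series_nth fps_mult_nth fls_nth_sum c)
qed

lemma q_free_mult:
  assumes "q_free F" "q_free G"
  shows "q_free (F * G)"
proof -
  obtain c d where "\<And>h. F $ h = fls_const (c h)" "\<And>h. G $ h = fls_const (d h)"
    using assms by (metis q_free_def)
  then have "(F * G) $ h = fls_const (\<Sum>i=0..h. c i * d (h - i))" for h
    by (intro fls_eqI) (simp add: fps_mult_nth fls_nth_sum)
  then show ?thesis unfolding q_free_def by blast
qed

lemma q_free_one: "q_free 1"
  unfolding q_free_def by (metis fls_const_0 fls_const_1 fps_one_nth)

lemma q_free_prod: "(\<And>i. i \<in> I \<Longrightarrow> q_free (F i)) \<Longrightarrow> q_free (prod F I)"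
  by (induction I rule: infinite_finite_induct) (auto simp: q_free_mult q_free_one)

lemma q_free_one_minus_X_power: "q_free (1 - fps_X ^ i)"
proof -
  have "(1 - fps_X ^ i :: rat fls fps) $ h =
      fls_const ((if h = 0 then 1 else 0) - (if h = i then 1 else 0))" for h
    by (auto simp: fps_X_power_nth)
  then show ?thesis unfolding q_free_def by blast
qed

text \<open>\<open>D * E * F\<close> splits into \<open>G\<close> with denominator
  \<open>P (-1)\<close> and \<open>H\<close> with denominator \<open>P 1\<close>. With growing
  \<open>h\<close> the exponents of \<open>q\<close> tend to minus infinity in \<open>G\<close> and
  to plus infinity in \<open>H\<close>, so the positive part of \<open>G\<close> and the nonpositive
  part of \<open>H\<close> are finite; \<open>P 1\<close> clears the denominator of
  \<open>H\<close>. \<open>E\<close> is for a factor of the denominator of \<open>F\<close> that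
  lies in neither product.\<close>

lemma pos_series_rational:
  fixes F :: "rat fls fps" and j :: "nat \<Rightarrow> int" and I :: "nat set"
  defines "P \<equiv> \<lambda>e. \<Prod>i\<in>I. lin (e * j i)"
  assumes j: "\<And>i. i \<in> I \<Longrightarrow> j i \<ge> 1"
    and C: "q_free D" "q_free E"
    and N: "E * F * P 1 * P (-1) \<in> laurent_zq"
    and D: "D = s * P 1 + t * P (-1)" "s \<in> laurent_zq" "t \<in> laurent_zq"
  shows "P 1 * (D * E * pos_series F) \<in> laurent_zq"
proof -
  define R where "R = (\<lambda>e. \<Prod>i\<in>I. geo (e * j i))"
  define N' where "N' = E * F * P 1 * P (-1)"
  have PR: "P e * R e = 1" for e
    by (simp add: P_def R_def prod.distrib[symmetric] lin_geo)
  have R: "grows e 0 (R e)" if "\<bar>e\<bar> = 1" for e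
  proof -
    have "e * e = 1" using that by (metis abs_mult_self_eq mult_1)
    then have ee: "e * (e * j i) = j i" for i by (metis mult.assoc mult_1)
    have "grows e 0 (geo (e * j i))" if "i \<in> I" for i
      by (rule grows_geo) (unfold ee, rule j[OF that])
    then show ?thesis unfolding R_def by (rule grows_prod)
  qed
  define G where "G = s * N' * R (-1)"
  define H where "H = t * N' * R 1"
  have "s * N' \<in> laurent_zq" "t * N' \<in> laurent_zq"
    using N D by (auto simp: N'_def)
  then obtain c c' where "grows (-1) c (s * N')" "grows 1 c' (t * N')"
    using laurent_zq_grows[of _ "-1"] laurent_zq_grows[of _ 1] by fastforce
  then have c: "grows (-1) c G" "grows 1 c' H"
    using grows_mult[of "-1" c _ 0] grows_mult[of 1 c' _ 0] R[of "-1"] R[of 1]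
    by (auto simp: G_def H_def)
  have "pos_series G \<in> laurent_zq"
  proof (rule laurent_zqI[of _ c])
    fix h n assume "pos_series G $ h $$ n \<noteq> 0"
    then have "n \<ge> 1" "G $ h $$ n \<noteq> 0" by (auto simp: pos_series_nth split: if_splits)
    then show "int h \<le> c \<and> \<bar>n\<bar> \<le> c" using c(1) by (force simp: grows_def)
  qed
  moreover have "H - pos_series H \<in> laurent_zq"
  proof (rule laurent_zqI[of _ c'])
    fix h n assume "(H - pos_series H) $ h $$ n \<noteq> 0"
    then have "n \<le> 0" "H $ h $$ n \<noteq> 0" by (auto simp: pos_series_nth split: if_splits)
    then show "int h \<le> c' \<and> \<bar>n\<bar> \<le> c'" using c(2) by (force simp: grows_def)
  qed
  moreover have P: "P e \<in> laurent_zq" for e by (auto simp: P_def)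
  moreover have "P 1 * H = t * N'"
  proof -
    have "P 1 * H = t * N' * (P 1 * R 1)" by (simp add: H_def mult_ac)
    then show ?thesis by (simp add: PR)
  qed
  moreover have "P 1 * (D * E * pos_series F) = P 1 * pos_series G + (P 1 * H - P 1 * (H - pos_series H))"
  proof -
    have "G = s * (E * F * P 1 * (P (-1) * R (-1)))" "H = t * (E * F * P (-1) * (P 1 * R 1))"
      by (simp_all add: G_def H_def N'_def mult_ac)
    then have "D * E * F = G + H"
      by (simp add: PR D(1) algebra_simps)
    then have "D * E * pos_series F = pos_series G + pos_series H"
      using pos_series_mult_q_free[OF q_free_mult[OF C], of F] by (simp add: pos_series_add)
    then show ?thesis by (simp add: algebra_simps)
  qed
  ultimately show ?thesis
    using \<open>t * N' \<in> laurent_zq\<close> by (simp add: laurent_zq_add laurent_zq_diff laurent_zq_mult)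
qed

text \<open>Only the factors with the largest indices are combined in each step, which is what keeps the
  left-hand side down to \<open>a + b - 1\<close> factors.\<close>

lemma bezout_products:
  fixes R :: "'a::comm_ring_1 set" and A B \<delta> :: "nat \<Rightarrow> 'a"
  assumes R: "0 \<in> R" "1 \<in> R" "\<And>x y. x \<in> R \<Longrightarrow> y \<in> R \<Longrightarrow> x + y \<in> R"
      "\<And>x y. x \<in> R \<Longrightarrow> y \<in> R \<Longrightarrow> x * y \<in> R"
    and AB: "\<And>i. A i \<in> R" "\<And>i. B i \<in> R" "\<And>i. \<delta> i \<in> R"
    and step: "\<And>a b. a \<ge> 1 \<Longrightarrow> b \<ge> 1 \<Longrightarrow> \<exists>s\<in>R. \<exists>t\<in>R. \<delta> (a + b - 1) = s * A a + t * B b"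
  shows "\<exists>s\<in>R. \<exists>t\<in>R. (\<Prod>i=1..a + b - 1. \<delta> i) = s * (\<Prod>i=1..a. A i) + t * (\<Prod>i=1..b. B i)"
proof (induction "a + b" arbitrary: a b)
  case 0
  then show ?case using R by (intro bexI[of _ 1] bexI[of _ 0]) auto
next
  case (Suc n)
  have prod_R: "(\<Prod>i=1..m. \<delta> i) \<in> R" for m
    by (induction m) (use R AB in auto)
  consider "a = 0" | "b = 0" | a' b' where "a = Suc a'" "b = Suc b'"
    by (metis not0_implies_Suc)
  then show ?case
  proof cases
    case 1
    then show ?thesis
      using R(1) prod_R by (intro bexI[of _ "\<Prod>i=1..a + b - 1. \<delta> i"] bexI[of _ 0]) auto
  next
    case 2
    then show ?thesis
      using R(1) prod_R by (intro bexI[of _ "\<Prod>i=1..a + b - 1. \<delta> i"] bexI[of _ 0]) auto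
  next
    case 3
    let ?D = "\<Prod>i=1..a' + b'. \<delta> i"
    let ?P = "\<lambda>n. \<Prod>i=1..n. A i" and ?M = "\<lambda>n. \<Prod>i=1..n. B i"
    obtain s t where st: "s \<in> R" "t \<in> R" "\<delta> (a + b - 1) = s * A a + t * B b"
      using step[of a b] 3 by auto
    \<comment> \<open>The pairs \<open>(a', b)\<close> and \<open>(a, b')\<close> both have
      \<open>?D\<close> on the left. Expanding it by the first pair next to \<open>A a\<close> and
      by the second next to \<open>B b\<close> makes every term a multiple of \<open>?P a\<close> or
      \<open>?M b\<close>.\<close>
    obtain s1 t1 where st1: "s1 \<in> R" "t1 \<in> R" "?D = s1 * ?P a' + t1 * ?M b"
      using Suc(1)[of a' b] Suc(2) 3 by auto
    obtain s2 t2 where st2: "s2 \<in> R" "t2 \<in> R" "?D = s2 * ?P a + t2 * ?M b'"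
      using Suc(1)[of a b'] Suc(2) 3 by auto
    have PM: "?P a = ?P a' * A a" "?M b = ?M b' * B b" using 3 by simp_all
    have "(\<Prod>i=1..a + b - 1. \<delta> i) = ?D * \<delta> (a + b - 1)" using 3 by simp
    also have "\<dots> = s * A a * ?D + t * B b * ?D" unfolding st(3) by (simp only: algebra_simps)
    also have "s * A a * ?D = s * s1 * ?P a + s * A a * t1 * ?M b"
      unfolding st1(3) PM(1) by (simp add: algebra_simps)
    also have "t * B b * ?D = t * B b * s2 * ?P a + t * t2 * ?M b"
      unfolding st2(3) PM(2) by (simp add: algebra_simps)
    finally have "(\<Prod>i=1..a + b - 1. \<delta> i) =
        (s * s1 + t * B b * s2) * ?P a + (s * A a * t1 + t * t2) * ?M b"
      by (simp add: algebra_simps)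
    moreover have "s * s1 + t * B b * s2 \<in> R" "s * A a * t1 + t * t2 \<in> R"
      using R AB st st1 st2 by auto
    ultimately show ?thesis by blast
  qed
qed

text \<open>For \<open>x = q^i z\<close> and \<open>y = q^-j z\<close> the hypothesis gives
  \<open>x^m y^n = z^(m+n)\<close>. In \<open>1 - x^m y^n = (1 - x^m) + x^m (1 - y^n)\<close> the
  brackets are geometric sums times \<open>lin i\<close> and \<open>lin (- j)\<close>.\<close>

lemma one_minus_X_power_bezout:
  assumes "i * int m = j * int n"
  shows "\<exists>s\<in>laurent_zq. \<exists>t\<in>laurent_zq. 1 - fps_X ^ (m + n) = s * lin i + t * lin (- j)"
proof -
  let ?a = "fps_const (qpow i) * fps_X" and ?b = "fps_const (qpow (- j)) * fps_X"
  have ab: "?a \<in> laurent_zq" "?b \<in> laurent_zq"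
    using laurent_zq_const_monom[of _ 1] by simp_all
  have "?a ^ m * ?b ^ n = fps_const (qpow i ^ m * qpow (- j) ^ n) * fps_X ^ (m + n)"
    by (simp add: power_mult_distrib fps_const_power power_add mult_ac)
  also have "qpow i ^ m * qpow (- j) ^ n = 1"
    using assms by (simp add: qpow_power qpow_add[symmetric])
  finally have "1 - fps_X ^ (m + n) = (1 - ?a ^ m) + ?a ^ m * (1 - ?b ^ n)"
    by (simp add: algebra_simps)
  also have "\<dots> = (\<Sum>k<m. ?a ^ k) * lin i + (?a ^ m * (\<Sum>k<n. ?b ^ k)) * lin (- j)"
    unfolding lin_def one_diff_power_eq by (simp add: mult_ac)
  finally show ?thesis
    using ab by (intro bexI[of _ "\<Sum>k<m. ?a ^ k"] bexI[of _ "?a ^ m * (\<Sum>k<n. ?b ^ k)"]) auto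
qed

section \<open>The generating series of principal specialisations\<close>

lemma prod_lin_nth_eq_0:
  "finite I \<Longrightarrow> h > card I \<Longrightarrow> (\<Prod>i\<in>I. lin (r i)) $ h = 0"
proof (induction I arbitrary: h rule: finite_induct)
  case (insert x I)
  obtain h' where h: "h = Suc h'" "h' > card I" using insert by (cases h) auto
  have "(lin (r x) * G) $ Suc h' = G $ Suc h' - qpow (r x) * G $ h'" for G
    by (simp add: lin_def left_diff_distrib mult.assoc)
  then show ?case using insert.IH[of h'] insert.IH[of h] h insert.hyps by simp
qed simp

text \<open>Partial fractions: each \<open>geo (r i)\<close> cancels one of the \<open>w + 1\<close>
  linear factors, which leaves degree at most \<open>w\<close> in \<open>z\<close>.\<close>

lemma geo_sum_mult_prod_lin_nth_eq_0:
  assumes F: "\<And>h. F $ h = (\<Sum>i\<le>w. c i * qpow (r i * int h))" and h: "h > w"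
  shows "(F * (\<Prod>i\<le>w. lin (r i))) $ h = 0"
proof -
  have F_eq: "F = (\<Sum>i\<le>w. fps_const (c i) * geo (r i))"
    by (rule fps_ext) (simp add: F fps_sum_nth geo_def)
  have "geo (r i) * (\<Prod>i\<le>w. lin (r i)) = (\<Prod>l\<in>{..w} - {i}. lin (r l))" if "i \<le> w" for i
  proof -
    have "geo (r i) * (\<Prod>i\<le>w. lin (r i)) = geo (r i) * (lin (r i) * (\<Prod>l\<in>{..w} - {i}. lin (r l)))"
      using that by (subst prod.remove[of _ i]) auto
    also have "\<dots> = (lin (r i) * geo (r i)) * (\<Prod>l\<in>{..w} - {i}. lin (r l))" by (simp only: mult_ac)
    finally show ?thesis by (simp add: lin_geo)
  qed
  then have "F * (\<Prod>i\<le>w. lin (r i)) = (\<Sum>i\<le>w. fps_const (c i) * (\<Prod>l\<in>{..w} - {i}. lin (r l)))"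
    unfolding F_eq sum_distrib_right by (intro sum.cong) (auto simp: mult.assoc)
  moreover have "(\<Prod>l\<in>{..w} - {i}. lin (r l)) $ h = 0" if "i \<le> w" for i
    using that h by (intro prod_lin_nth_eq_0) (auto simp: card_Diff_subset)
  ultimately show ?thesis by (simp add: fps_sum_nth)
qed

lemma qpow_power_neq_1: "i \<ge> 1 \<Longrightarrow> qpow 2 ^ i \<noteq> 1"
proof
  assume "i \<ge> 1" "qpow 2 ^ i = 1"
  then have "qpow (2 * int i) $$ 0 = 1" by (simp add: qpow_power)
  then show False using \<open>i \<ge> 1\<close> by (simp add: qpow_nth)
qed

text \<open>Homogeneity of degree \<open>w\<close> takes out \<open>q^(-hw)\<close> and leaves the
  variables \<open>(q^2)^i\<close>. There are \<open>h + 1\<close> of them, so a factor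
  \<open>q^(2i)\<close> independent of \<open>h\<close> moves into the coefficients.\<close>

lemma schur_spec_exponential:
  assumes "partition_of w \<mu>"
  shows "\<exists>c. \<forall>h. schur_spec \<mu> h = (\<Sum>i\<le>w. c i * qpow ((2 * int i - int w) * int h))"
proof -
  let ?Y = "young_diagram \<mu>"
  obtain c where c: "\<And>n. filling_sum row_less col_less ?Y n (\<lambda>i. qpow 2 ^ i) =
      (\<Sum>i\<le>w. c i * qpow 2 ^ (i * n))"
    using filling_sum_geometric_span[OF qpow_power_neq_1 finite_young_diagram[of \<mu>], of row_less col_less]
    unfolding card_young_diagram[OF assms] by metis
  have "schur_spec \<mu> h = (\<Sum>i\<le>w. c i * qpow (2 * int i) * qpow ((2 * int i - int w) * int h))" for h
  proof -
    have x: "qpow (2 * int i - int h) = qpow (- int h) * qpow 2 ^ i" for i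
      by (simp add: qpow_power qpow_add[symmetric])
    have "schur_spec \<mu> h = qpow (- int h) ^ w * schur \<mu> (h + 1) (\<lambda>i. qpow 2 ^ i)"
      unfolding schur_spec_def schur_def qpow_def[symmetric] x prod.distrib prod_constant
        card_young_diagram[OF assms] sum_distrib_left ..
    also have "\<dots> = (\<Sum>i\<le>w. qpow (- int h) ^ w * (c i * qpow 2 ^ (i * (h + 1))))"
      by (simp only: schur_eq_filling_sum c sum_distrib_left)
    also have "\<dots> = (\<Sum>i\<le>w. c i * qpow (2 * int i) * qpow ((2 * int i - int w) * int h))"
    proof (rule sum.cong[OF refl])
      fix i
      have "qpow (- int h) ^ w * (c i * qpow 2 ^ (i * (h + 1))) =
          c i * qpow (- int h * int w + 2 * int (i * (h + 1)))"
        by (simp only: qpow_power qpow_add mult_ac)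
      also have "- int h * int w + 2 * int (i * (h + 1)) = 2 * int i + (2 * int i - int w) * int h"
        by (simp add: algebra_simps)
      finally show "qpow (- int h) ^ w * (c i * qpow 2 ^ (i * (h + 1))) =
          c i * qpow (2 * int i) * qpow ((2 * int i - int w) * int h)"
        by (simp only: qpow_add mult_ac)
    qed
    finally show ?thesis .
  qed
  then show ?thesis by (intro exI[of _ "\<lambda>i. c i * qpow (2 * int i)"]) simp
qed

definition schur_series :: "nat list \<Rightarrow> rat fls fps" where
  "schur_series \<mu> = Abs_fps (\<lambda>h. (qpow 1 - qpow (-1)) * schur_spec \<mu> h)"

lemma fps_const_sum: "fps_const (\<Sum>x\<in>A. f x) = (\<Sum>x\<in>A. fps_const (f x))"
  by (rule fps_ext) (simp add: fps_sum_nth)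

lemma laurent_zq_schur_series_coeff: "fps_const (schur_series \<mu> $ h) \<in> laurent_zq"
proof -
  have q: "fps_const (qpow i) \<in> laurent_zq" for i
    using laurent_zq_const_monom[of i 0] by simp
  have "fps_const (schur_series \<mu> $ h) =
      (fps_const (qpow 1) - fps_const (qpow (-1))) * fps_const (schur_spec \<mu> h)"
    by (simp add: schur_series_def)
  moreover have "fps_const (schur_spec \<mu> h) \<in> laurent_zq"
    unfolding schur_spec_qpow fps_const_sum by (intro laurent_zq_sum q)
  ultimately show ?thesis using q by (metis laurent_zq_diff laurent_zq_mult)
qed

text \<open>The exponential form bounds the degree in \<open>z\<close>, but its coefficients
  \<open>c i\<close> are only known to be Laurent series. Boundedness in \<open>q\<close> comes from
  the truncation \<open>G\<close>, whose finitely many coefficients are Laurent polynomials and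
  which gives the same product up to \<open>z^w\<close>.\<close>

lemma schur_series_mult_prod_lin:
  assumes "partition_of w \<mu>"
  shows "schur_series \<mu> * (\<Prod>i\<le>w. lin (2 * int i - int w)) \<in> laurent_zq"
proof -
  let ?F = "schur_series \<mu>" and ?P = "\<Prod>i\<le>w. lin (2 * int i - int w)"
  define G where "G = (\<Sum>h\<le>w. fps_const (?F $ h) * fps_X ^ h)"
  have G: "G $ h = ?F $ h" if "h \<le> w" for h
    using that by (simp add: G_def fps_sum_nth fps_X_power_nth if_distrib sum.delta cong: if_cong)
  have "G * ?P \<in> laurent_zq"
    unfolding G_def
    by (intro laurent_zq_mult laurent_zq_sum laurent_zq_prod laurent_zq_schur_series_coeff
        laurent_zq_X_power laurent_zq_lin)
  then obtain M where M: "\<And>h n. (G * ?P) $ h $$ n \<noteq> 0 \<Longrightarrow> int h \<le> M \<and> \<bar>n\<bar> \<le> M"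
    by (auto simp: laurent_zq_def)
  obtain c where c: "\<And>h. schur_spec \<mu> h = (\<Sum>i\<le>w. c i * qpow ((2 * int i - int w) * int h))"
    using schur_spec_exponential[OF assms] by blast
  have vanish: "(?F * ?P) $ h = 0" if "h > w" for h
    using _ that
  proof (rule geo_sum_mult_prod_lin_nth_eq_0)
    show "?F $ h = (\<Sum>i\<le>w. (qpow 1 - qpow (-1)) * c i * qpow ((2 * int i - int w) * int h))" for h
      by (simp add: schur_series_def c sum_distrib_left mult.assoc)
  qed
  show ?thesis
  proof (rule laurent_zqI[of _ M])
    fix h n assume nz: "(?F * ?P) $ h $$ n \<noteq> 0"
    then have "h \<le> w" using vanish[of h] by (cases "h \<le> w") auto
    then have "(?F * ?P) $ h = (G * ?P) $ h"
      unfolding fps_mult_nth by (intro sum.cong) (auto simp: G)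
    then show "int h \<le> M \<and> \<bar>n\<bar> \<le> M" using M nz by simp
  qed
qed

text \<open>Each induction step splits off the two outermost factors. The multipliers
  \<open>1\<close> and \<open>-1\<close> match \<open>P 1\<close> and \<open>P (-1)\<close> in
  \<open>pos_series_rational\<close>.\<close>

lemma prod_symmetric_even:
  fixes f :: "int \<Rightarrow> 'a::comm_monoid_mult"
  shows "(\<Prod>i\<le>2 * n. f (2 * int i - int (2 * n))) =
    f 0 * (\<Prod>i=1..n. f (1 * (2 * int i))) * (\<Prod>i=1..n. f (-1 * (2 * int i)))"
proof (induction n)
  case (Suc n)
  let ?g = "\<lambda>i. f (2 * int i - int (2 * Suc n))"
  have "(\<Prod>i\<le>2 * Suc n. ?g i) = ?g 0 * (\<Prod>i\<le>2 * n. ?g (Suc i)) * ?g (Suc (Suc (2 * n)))"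
    by (simp only: mult_Suc_right add_2_eq_Suc prod.atMost_Suc_shift[of _ "Suc (2 * n)"]
        prod.atMost_Suc[of _ "2 * n"] mult.assoc)
  also have "(\<Prod>i\<le>2 * n. ?g (Suc i)) = (\<Prod>i\<le>2 * n. f (2 * int i - int (2 * n)))"
    by (intro prod.cong) auto
  also note Suc.IH
  also have "?g 0 = f (-1 * (2 * int (Suc n)))" by simp
  also have "?g (Suc (Suc (2 * n))) = f (1 * (2 * int (Suc n)))" by (rule arg_cong[of _ _ f]) simp
  finally show ?case by (simp add: mult_ac)
qed simp

lemma prod_symmetric_odd:
  fixes f :: "int \<Rightarrow> 'a::comm_monoid_mult"
  shows "(\<Prod>i\<le>2 * n + 1. f (2 * int i - int (2 * n + 1))) =
    (\<Prod>i=1..n + 1. f (1 * (2 * int i - 1))) * (\<Prod>i=1..n + 1. f (-1 * (2 * int i - 1)))"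
proof (induction n)
  case (Suc n)
  let ?g = "\<lambda>i. f (2 * int i - int (2 * Suc n + 1))"
  have e: "2 * Suc n + 1 = Suc (Suc (2 * n + 1))" by simp
  have "(\<Prod>i\<le>2 * Suc n + 1. ?g i) = (\<Prod>i\<le>Suc (Suc (2 * n + 1)). ?g i)" unfolding e ..
  also have "\<dots> = ?g 0 * (\<Prod>i\<le>2 * n + 1. ?g (Suc i)) * ?g (Suc (Suc (2 * n + 1)))"
    by (simp only: prod.atMost_Suc_shift[of _ "Suc (2 * n + 1)"]
        prod.atMost_Suc[of _ "2 * n + 1"] mult.assoc)
  also have "(\<Prod>i\<le>2 * n + 1. ?g (Suc i)) = (\<Prod>i\<le>2 * n + 1. f (2 * int i - int (2 * n + 1)))"
    by (intro prod.cong refl arg_cong[of _ _ f]) simp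
  also note Suc.IH
  also have "?g 0 = f (-1 * (2 * int (Suc n + 1) - 1))" by (rule arg_cong[of _ _ f]) simp
  also have "?g (Suc (Suc (2 * n + 1))) = f (1 * (2 * int (Suc n + 1) - 1))"
    by (rule arg_cong[of _ _ f]) simp
  finally show ?case by (simp add: mult_ac)
qed (simp add: mult.commute)

section \<open>From integer power series to Laurent series over the rationals\<close>

definition embed_q :: "int fps \<Rightarrow> rat fls" where
  "embed_q f = fps_to_fls (Abs_fps (\<lambda>n. of_int (f $ n)))"

lemma embed_q_nth: "embed_q f $$ n = (if n \<ge> 0 then of_int (f $ nat n) else 0)"
  by (auto simp: embed_q_def)

lemma embed_q_0 [simp]: "embed_q 0 = 0"
  by (intro fls_eqI) (simp add: embed_q_nth)

lemma embed_q_1 [simp]: "embed_q 1 = 1"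
  by (intro fls_eqI) (auto simp: embed_q_nth)

lemma embed_q_X [simp]: "embed_q fps_X = qpow 1"
  by (intro fls_eqI) (auto simp: embed_q_nth qpow_nth)

lemma embed_q_mult: "embed_q (f * g) = embed_q f * embed_q g"
  unfolding embed_q_def fls_times_fps_to_fls[symmetric]
  by (intro arg_cong[of _ _ fps_to_fls] fps_ext) (simp add: fps_mult_nth)

lemma embed_q_diff: "embed_q (f - g) = embed_q f - embed_q g"
  by (intro fls_eqI) (simp add: embed_q_nth)

lemma embed_q_sum: "embed_q (\<Sum>i\<in>I. f i) = (\<Sum>i\<in>I. embed_q (f i))"
  by (intro fls_eqI) (simp add: embed_q_nth fls_nth_sum fps_sum_nth)

definition embed_zq :: "int fps fps \<Rightarrow> rat fls fps" where
  "embed_zq F = Abs_fps (\<lambda>h. embed_q (F $ h))"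

lemma embed_zq_1 [simp]: "embed_zq 1 = 1"
  by (rule fps_ext) (simp add: embed_zq_def)

lemma embed_zq_X [simp]: "embed_zq fps_X = fps_X"
  by (rule fps_ext) (simp add: embed_zq_def fps_X_def)

lemma embed_zq_const: "embed_zq (fps_const f) = fps_const (embed_q f)"
  by (rule fps_ext) (simp add: embed_zq_def)

lemma embed_zq_mult: "embed_zq (F * G) = embed_zq F * embed_zq G"
  by (rule fps_ext) (simp add: embed_zq_def fps_mult_nth embed_q_sum embed_q_mult)

lemma embed_zq_diff: "embed_zq (F - G) = embed_zq F - embed_zq G"
  by (rule fps_ext) (simp add: embed_zq_def embed_q_diff)

lemma embed_zq_power: "embed_zq (F ^ n) = embed_zq F ^ n"
  by (induction n) (simp_all add: embed_zq_mult)

lemma embed_zq_prod: "embed_zq (\<Prod>i\<in>I. F i) = (\<Prod>i\<in>I. embed_zq (F i))"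
  by (induction I rule: infinite_finite_induct) (simp_all add: embed_zq_mult)

lemma embed_zq_lin: "embed_zq (1 - qvar ^ n * zvar) = lin (int n)"
proof -
  have "fps_const (qpow 1) ^ n = fps_const (qpow (int n))" by (simp add: fps_const_power qpow_power)
  then show ?thesis
    by (simp only: embed_zq_diff embed_zq_mult embed_zq_power embed_zq_const embed_zq_1
        embed_zq_X embed_q_X lin_def)
qed

lemma embed_zq_A_series:
  assumes "partition_of w \<mu>"
  shows "embed_zq (A_series \<mu>) = pos_series (schur_series \<mu>)"
proof (intro fps_ext fls_eqI)
  fix h n
  show "embed_zq (A_series \<mu>) $ h $$ n = pos_series (schur_series \<mu>) $ h $$ n"
    using schur_coeff_eq[OF assms, of h "nat n"]
    by (auto simp: embed_zq_def embed_q_nth A_series_def pos_series_nth schur_series_def)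
qed

text \<open>Integrality and nonnegative exponents are built into the type of \<open>F\<close>, so a
  bounded support of its image is all that remains.\<close>

lemma polys_zqI:
  assumes "embed_zq F \<in> laurent_zq"
  shows "F \<in> polys_zq"
proof -
  obtain M where M: "\<And>h n. embed_zq F $ h $$ n \<noteq> 0 \<Longrightarrow> int h \<le> M \<and> \<bar>n\<bar> \<le> M"
    using assms by (auto simp: laurent_zq_def)
  define m where "m = nat M"
  have m: "h \<le> m \<and> k \<le> m" if "F $ h $ k \<noteq> 0" for h k
    using M[of h "int k"] that by (auto simp: embed_zq_def embed_q_nth m_def)
  define P where "P = (\<Sum>h\<le>m. monom (truncate_fps (Suc m) (F $ h)) h)"
  have coeff_P: "coeff P h = (if h \<le> m then truncate_fps (Suc m) (F $ h) else 0)" for h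
    by (simp add: P_def coeff_sum sum.delta)
  have "F = fps_of_poly (map_poly fps_of_poly P)"
  proof (intro fps_ext)
    fix h k
    show "F $ h $ k = fps_of_poly (map_poly fps_of_poly P) $ h $ k"
      using m[of h k]
      by (cases "F $ h $ k = 0") (auto simp: coeff_map_poly coeff_P coeff_truncate_fps not_le)
  qed
  then show ?thesis unfolding polys_zq_def by blast
qed

text \<open>The factors \<open>1 - q^(2a) z\<close> and \<open>1 - q^(-2b) z\<close> are combined
  with the powers \<open>b\<close> and \<open>a\<close>. The resulting \<open>1 - z^(a+b)\<close>
  depends on \<open>a + b\<close> only, as \<open>bezout_products\<close> demands.\<close>

lemma bezout_even:
  "\<exists>s\<in>laurent_zq. \<exists>t\<in>laurent_zq. (\<Prod>i=1..a + b - 1. 1 - fps_X ^ Suc i) =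
    s * (\<Prod>i=1..a. lin (1 * (2 * int i))) + t * (\<Prod>i=1..b. lin (-1 * (2 * int i)))"
proof (rule bezout_products)
  fix a b :: nat assume "a \<ge> 1" "b \<ge> 1"
  then show "\<exists>s\<in>laurent_zq. \<exists>t\<in>laurent_zq. 1 - fps_X ^ Suc (a + b - 1) =
      s * lin (1 * (2 * int a)) + t * lin (-1 * (2 * int b))"
    using one_minus_X_power_bezout[of "2 * int a" b "2 * int b" a] by (simp add: add.commute)
qed (auto simp del: power_Suc)

text \<open>Here the powers are \<open>2b - 1\<close> and \<open>2a - 1\<close>, with sum
  \<open>2(a + b - 1)\<close>.\<close>

lemma bezout_odd:
  "\<exists>s\<in>laurent_zq. \<exists>t\<in>laurent_zq. (\<Prod>i=1..a + b - 1. 1 - fps_X ^ (2 * i)) =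
    s * (\<Prod>i=1..a. lin (1 * (2 * int i - 1))) + t * (\<Prod>i=1..b. lin (-1 * (2 * int i - 1)))"
proof (rule bezout_products)
  fix a b :: nat assume ab: "a \<ge> 1" "b \<ge> 1"
  have "(2 * b - 1) + (2 * a - 1) = 2 * (a + b - 1)" using ab by simp
  then show "\<exists>s\<in>laurent_zq. \<exists>t\<in>laurent_zq. 1 - fps_X ^ (2 * (a + b - 1)) =
      s * lin (1 * (2 * int a - 1)) + t * lin (-1 * (2 * int b - 1))"
    using one_minus_X_power_bezout[of "2 * int a - 1" "2 * b - 1" "2 * int b - 1" "2 * a - 1"] ab
    by (simp add: of_nat_diff mult.commute)
qed auto

theorem theorem4p9:
  fixes w :: nat and \<mu> :: "nat list"
  assumes "w > 0" and "partition_of w \<mu>"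
  shows "d_poly w * A_series \<mu> \<in> polys_zq"
proof (rule polys_zqI, cases "even w")
  case True
  then obtain n where n: "w = 2 * n" "n > 0" using assms(1) by (auto elim: evenE)
  \<comment> \<open>These \<open>w - 1\<close> factors are \<open>1 - z^i\<close> for
    \<open>i = 2, ..., w\<close>.\<close>
  define D where "D = (\<Prod>i=1..n + n - 1. 1 - fps_X ^ Suc i :: rat fls fps)"
  define P where "P e = (\<Prod>i=1..n. lin (e * (2 * int i)))" for e
  let ?A = "pos_series (schur_series \<mu>)"
  obtain s t where st: "s \<in> laurent_zq" "t \<in> laurent_zq" "D = s * P 1 + t * P (-1)"
    using bezout_even[of n n] unfolding D_def P_def by blast
  \<comment> \<open>The exponent \<open>0\<close> contributes the factor \<open>1 - z\<close>, which
    serves as \<open>E\<close> below.\<close>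
  have lin0: "lin 0 = 1 - fps_X" by (simp add: lin_def)
  have "(1 - fps_X) * schur_series \<mu> * P 1 * P (-1) =
      schur_series \<mu> * (\<Prod>i\<le>w. lin (2 * int i - int w))"
    unfolding n(1) prod_symmetric_even lin0 P_def by (simp only: mult_ac)
  then have N: "(1 - fps_X) * schur_series \<mu> * P 1 * P (-1) \<in> laurent_zq"
    using schur_series_mult_prod_lin[OF assms(2)] by (simp only:)
  have "q_free D" unfolding D_def by (intro q_free_prod q_free_one_minus_X_power)
  moreover have "q_free (1 - fps_X)" using q_free_one_minus_X_power[of 1] by simp
  ultimately have "P 1 * (D * (1 - fps_X) * ?A) \<in> laurent_zq"
    using N st(3,1,2) unfolding P_def by (intro pos_series_rational[where s = s and t = t]) auto
  \<comment> \<open>The factor for \<open>i = 1\<close> is set apart: of the two factors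
    \<open>1 - z\<close> of \<open>d_poly w\<close>, one serves as \<open>E\<close> and the other
    stays in front.\<close>
  moreover have "(\<Prod>i=1..w. 1 - fps_X ^ i) = (1 - fps_X) * D"
  proof -
    have "(\<Prod>i=1..Suc m. 1 - fps_X ^ i :: rat fls fps) =
        (1 - fps_X) * (\<Prod>i=1..m. 1 - fps_X ^ Suc i)" for m
      by (induction m) (simp_all add: mult.assoc del: power_Suc)
    from this[of "w - 1"] show ?thesis using n by (simp add: D_def mult_2 del: power_Suc)
  qed
  then have "embed_zq (d_poly w * A_series \<mu>) = (1 - fps_X) * (P 1 * (D * (1 - fps_X) * ?A))"
    using True n embed_zq_lin[of "2 * _"]
    by (simp add: d_poly_def embed_zq_mult embed_zq_prod embed_zq_diff embed_zq_power
        embed_zq_A_series[OF assms(2)] P_def mult_ac)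
  ultimately show "embed_zq (d_poly w * A_series \<mu>) \<in> laurent_zq"
    using laurent_zq_X_power[of 1] by auto
next
  case False
  then obtain n where n: "w = 2 * n + 1" by (auto elim: oddE)
  \<comment> \<open>With \<open>n + 1\<close> linear factors on each side, \<open>D\<close> has
    \<open>2 * n + 1 = w\<close> factors. All exponents of \<open>q\<close> are odd, so there is no
    middle factor and \<open>E = 1\<close>.\<close>
  define D where "D = (\<Prod>i=1..(n + 1) + (n + 1) - 1. 1 - fps_X ^ (2 * i) :: rat fls fps)"
  define P where "P e = (\<Prod>i=1..n + 1. lin (e * (2 * int i - 1)))" for e
  let ?A = "pos_series (schur_series \<mu>)"
  obtain s t where st: "s \<in> laurent_zq" "t \<in> laurent_zq" "D = s * P 1 + t * P (-1)"
    using bezout_odd[of "n + 1" "n + 1"] unfolding D_def P_def by blast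
  have "1 * schur_series \<mu> * P 1 * P (-1) =
      schur_series \<mu> * (\<Prod>i\<le>w. lin (2 * int i - int w))"
    unfolding n(1) prod_symmetric_odd P_def by (simp only: mult_ac mult_1)
  then have N: "1 * schur_series \<mu> * P 1 * P (-1) \<in> laurent_zq"
    using schur_series_mult_prod_lin[OF assms(2)] by (simp only:)
  have "q_free D" unfolding D_def by (intro q_free_prod q_free_one_minus_X_power)
  then have "P 1 * (D * 1 * ?A) \<in> laurent_zq"
    using q_free_one N st(3,1,2) unfolding P_def
    by (intro pos_series_rational[where s = s and t = t]) auto
  moreover have "embed_zq (d_poly w * A_series \<mu>) = P 1 * (D * 1 * ?A)"
  proof -
    have "(\<Prod>i=1..n + 1. embed_zq (1 - qvar ^ (2 * i - 1) * zvar)) = P 1"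
      unfolding P_def embed_zq_lin by (intro prod.cong) (auto simp: of_nat_diff)
    moreover have "(w + 1) div 2 = n + 1" "n + 1 + (n + 1) - 1 = w" using n by simp_all
    ultimately show ?thesis
      using False by (simp add: d_poly_def embed_zq_mult embed_zq_prod embed_zq_diff embed_zq_power
          embed_zq_A_series[OF assms(2)] D_def mult_ac)
  qed
  ultimately show "embed_zq (d_poly w * A_series \<mu>) \<in> laurent_zq" by simp
qed

end
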